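(* There exists an algorithm which takes as input $(\boldsymbol{g},\mathbf{h},F)$, where $\boldsymbol{g}=(g_1,\ldots,g_m)$ and $\mathbf{h}=(h_1,\ldots,h_l)$ are polynomials in $\mathbb{Q}[x_1,\ldots,x_n]$ and $F=(F_1,\ldots,F_k)$ is a tuple of polynomial maps $\mathbb{C}^n\to\mathbb{C}^n$ with coefficients in $\mathbb{Q}$, and which outputs a polynomial matrix $A$ (with entries in $\mathbb{Q}[x_1,\ldots,x_n]$) such that for any $\mathbf{a}\in\mathbb{C}^n$, $$I_{\mathcal{L}(\mathbf{a},\mathbf{h},F),E}=\left\{\sum_{i=1}^m b_i\,g_i\ \Big|\ (b_1,\ldots,b_m)\in\ker A(\mathbf{a})\right\},$$ where $E\subset\mathbb{C}[x_1,\ldots,x_n]$ is the vector space spanned by $\boldsymbol{g}$ and $\ker A(\mathbf{a})$ is the right kernel of $A$ evaluated at $\mathbf{a}$.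
   Context: Notation: $\mathbf{x}=(x_1,\ldots,x_n)$, $[k]=\{1,\ldots,k\}$. For $i_1,\ldots,i_m\in[k]$, $F_{i_1,\ldots,i_m}=F_{i_m}\circ\cdots\circ F_{i_1}$, with the empty composition equal to the identity. Branching loop: $\mathcal{L}(\mathbf{a},\mathbf{h},(F_1,\ldots,F_k))$ is the loop which initializes $\mathbf{x}=\mathbf{a}$ and, while $h_1(\mathbf{x})\neq0,\ldots,h_l(\mathbf{x})\neq0$ (equivalently $h(\mathbf{x})\neq0$ with $h=h_1\cdots h_l$), nondeterministically chooses $i\in[k]$ and performs $\mathbf{x}\leftarrow F_i(\mathbf{x})$. A polynomial $g\in\mathbb{C}[\mathbf{x}]$ is a polynomial invariant of the loop if $g(\mathbf{a})=0$ and, for every $m\in\mathbb{N}$ and every $i_1,\ldots,i_m\in[k]$, either $g(F_{i_1}(\mathbf{a}))=\cdots=g(F_{i_1,\ldots,i_m}(\mathbf{a}))=0$, or there is $0\le l'<m$ such that $g(F_{i_1}(\mathbf{a}))=\cdots=g(F_{i_1,\ldots,i_{l'}}(\mathbf{a}))=0$ and $h(F_{i_1,\ldots,i_{l'}}(\mathbf{a}))=0$. $I_{\mathcal{L}(\mathbf{a},\mathbf{h},F),E}$ is the set of polynomial invariants of the loop lying in $E$. *)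

theory Defs
  imports
    "HOL-Library.Poly_Mapping"
    "HOL-Library.Nat_Bijection"
    "Jordan_Normal_Form.Matrix_Kernel"
begin

section \<open>Algorithms: partial recursive functions\<close>

datatype recf =
    Zero
  | Succ
  | Proj nat
  | Comp recf "recf list"
  | PrimRec recf recf
  | Mu recf

text \<open>\<open>computes e xs y\<close>: running \<open>e\<close> on the arguments \<open>xs\<close> terminates with result \<open>y\<close>.
  In primitive recursion the first argument is the recursion argument, and the step function
  receives the counter, the previous value and the parameters, in this order.
  Minimisation searches over a new first argument.\<close>

inductive computes :: "recf \<Rightarrow> nat list \<Rightarrow> nat \<Rightarrow> bool" where
  zero: "computes Zero xs 0"
| succ: "computes Succ (x # xs) (Suc x)"
| proj: "i < length xs \<Longrightarrow> computes (Proj i) xs (xs ! i)"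
| comp: "list_all2 (\<lambda>g y. computes g xs y) gs ys \<Longrightarrow> computes f ys z
    \<Longrightarrow> computes (Comp f gs) xs z"
| primrec_0: "computes f xs y \<Longrightarrow> computes (PrimRec f g) (0 # xs) y"
| primrec_Suc: "computes (PrimRec f g) (n # xs) r \<Longrightarrow> computes g (n # r # xs) y
    \<Longrightarrow> computes (PrimRec f g) (Suc n # xs) y"
| mu: "computes f (n # xs) 0 \<Longrightarrow> (\<forall>i<n. \<exists>y. computes f (i # xs) (Suc y))
    \<Longrightarrow> computes (Mu f) xs n"

lemma computes_deterministic:
  assumes "computes e xs y" "computes e xs z"
  shows "y = z"
  using assms
proof (induction e xs y arbitrary: z rule: computes.induct)
  case (comp xs gs ys f z z')
  from comp.prems obtain ys' where ys':
    "list_all2 (\<lambda>g y. computes g xs y) gs ys'" "computes f ys' z'"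
    by (cases rule: computes.cases) auto
  have "ys = ys'"
    using comp.IH(1) ys'(1) by (auto simp: list_all2_conv_all_nth intro!: nth_equalityI)
  with comp ys' show ?case by blast
next
  case (primrec_Suc f g n xs r y)
  from primrec_Suc.prems obtain r' where
    "computes (PrimRec f g) (n # xs) r'" "computes g (n # r' # xs) z"
    by (cases rule: computes.cases) auto
  with primrec_Suc.IH show ?case by blast
next
  case (mu f n xs)
  from mu.prems have "computes f (z # xs) 0 \<and> (\<forall>i<z. \<exists>y. computes f (i # xs) (Suc y))"
    by (cases rule: computes.cases) simp
  then have z: "computes f (z # xs) 0" "\<forall>i<z. \<exists>y. computes f (i # xs) (Suc y)"
    by blast+
  have "z = n" if "z < n"
    using mu.IH(2) z(1) that by (metis nat.distinct(1))
  moreover have "z = n" if "n < z"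
    using mu.IH(1) z(2) that by (metis nat.distinct(1))
  ultimately show ?case by linarith
next
  case (zero xs)
  then show ?case by (cases rule: computes.cases) simp
next
  case (succ x xs)
  then show ?case by (cases rule: computes.cases) simp
next
  case (proj i xs)
  from proj.prems show ?case by (cases rule: computes.cases) simp
next
  case (primrec_0 f xs y g)
  from primrec_0.prems have "computes f xs z" by (cases rule: computes.cases) simp
  with primrec_0.IH show ?case by blast
qed


section \<open>Multivariate polynomials\<close>

text \<open>A polynomial maps exponent functions to coefficients. Variables are indexed from 0, so
  the variables \<open>x\<^sub>1, \<dots>, x\<^sub>n\<close> are those with index \<open>< n\<close>.\<close>

type_synonym 'a mpoly = "(nat \<Rightarrow>\<^sub>0 nat) \<Rightarrow>\<^sub>0 'a"

definition mpolys :: "nat \<Rightarrow> 'a::zero mpoly set" where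
  "mpolys n = {p. \<forall>m \<in> Poly_Mapping.keys p. Poly_Mapping.keys m \<subseteq> {..<n}}"

definition mpoly_eval :: "'a::comm_semiring_1 mpoly \<Rightarrow> 'a vec \<Rightarrow> 'a" where
  "mpoly_eval p a = (\<Sum>m \<in> Poly_Mapping.keys p. Poly_Mapping.lookup p m *
     (\<Prod>i \<in> Poly_Mapping.keys m. (a $ i) ^ Poly_Mapping.lookup m i))"

definition cpoly :: "rat mpoly \<Rightarrow> complex mpoly" where
  "cpoly p = Poly_Mapping.map of_rat p"

definition mpoly_scale :: "'a::comm_ring_1 \<Rightarrow> 'a mpoly \<Rightarrow> 'a mpoly" where
  "mpoly_scale c p = Poly_Mapping.map ((*) c) p"

global_interpretation cmpoly: vector_space "mpoly_scale :: complex \<Rightarrow> complex mpoly \<Rightarrow> complex mpoly"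
proof -
  have scale: "mpoly_scale c p = Poly_Mapping.single 0 c * p" for c :: complex and p
    by (simp only: mpoly_scale_def mult_map_scale_conv_mult)
  show "vector_space (mpoly_scale :: complex \<Rightarrow> complex mpoly \<Rightarrow> complex mpoly)"
  proof
    fix a b :: complex and x y :: "complex mpoly"
    show "mpoly_scale a (x + y) = mpoly_scale a x + mpoly_scale a y"
      by (simp only: scale distrib_left)
    show "mpoly_scale (a + b) x = mpoly_scale a x + mpoly_scale b x"
      by (simp only: scale single_add distrib_right)
    have "Poly_Mapping.single 0 a * Poly_Mapping.single 0 b =
        (Poly_Mapping.single 0 (a * b) :: complex mpoly)"
      by (simp only: mult_single add_0_left)
    then show "mpoly_scale a (mpoly_scale b x) = mpoly_scale (a * b) x"
      by (simp only: scale mult.assoc[symmetric])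
    show "mpoly_scale 1 x = x"
      by (simp only: scale single_one mult_1_left)
  qed
qed


section \<open>Branching loops and their polynomial invariants\<close>

text \<open>A polynomial map is the list of its coordinate polynomials.\<close>

definition polymap :: "rat mpoly list \<Rightarrow> complex vec \<Rightarrow> complex vec" where
  "polymap F x = vec (length F) (\<lambda>j. mpoly_eval (cpoly (F ! j)) x)"

text \<open>\<open>branch Fs [i\<^sub>1, \<dots>, i\<^sub>m]\<close> is the composition in which the map with index \<open>i\<^sub>1\<close> is applied
  first. Branches are indexed from 0.\<close>

definition branch :: "rat mpoly list list \<Rightarrow> nat list \<Rightarrow> complex vec \<Rightarrow> complex vec" where
  "branch Fs is = fold (\<lambda>i. polymap (Fs ! i)) is"

definition poly_invariant ::
  "complex vec \<Rightarrow> rat mpoly list \<Rightarrow> rat mpoly list list \<Rightarrow> complex mpoly \<Rightarrow> bool" where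
  "poly_invariant a hs Fs g \<longleftrightarrow>
     mpoly_eval g a = 0 \<and>
     (\<forall>is. set is \<subseteq> {..<length Fs} \<longrightarrow>
        (\<forall>j \<in> {1..length is}. mpoly_eval g (branch Fs (take j is) a) = 0) \<or>
        (\<exists>l < length is.
           (\<forall>j \<in> {1..l}. mpoly_eval g (branch Fs (take j is) a) = 0) \<and>
           mpoly_eval (cpoly (prod_list hs)) (branch Fs (take l is) a) = 0))"

definition invariants_in ::
  "complex mpoly set \<Rightarrow> complex vec \<Rightarrow> rat mpoly list \<Rightarrow> rat mpoly list list \<Rightarrow> complex mpoly set"
where
  "invariants_in E a hs Fs = {g \<in> E. g \<in> mpolys (dim_vec a) \<and> poly_invariant a hs Fs g}"


section \<open>Input and output of the algorithm\<close>

definition rat_code :: "rat \<Rightarrow> nat" where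
  "rat_code q = (case quotient_of q of (a, b) \<Rightarrow> prod_encode (int_encode a, nat b))"

definition term_code :: "rat \<times> nat list \<Rightarrow> nat" where
  "term_code t = prod_encode (rat_code (fst t), list_encode (snd t))"

text \<open>A polynomial in \<open>n\<close> variables is given by any list of terms (coefficient, exponent vector)
  summing up to it; the order of the terms is arbitrary and exponent vectors may be repeated.\<close>

definition mpoly_code :: "nat \<Rightarrow> rat mpoly \<Rightarrow> nat \<Rightarrow> bool" where
  "mpoly_code n p c \<longleftrightarrow> (\<exists>ts.
     c = list_encode (map term_code ts) \<and>
     (\<forall>t \<in> set ts. length (snd t) = n) \<and>
     p = (\<Sum>t\<leftarrow>ts. Poly_Mapping.single (Poly_Mapping.nth (snd t)) (fst t)))"

definition input_code ::
  "nat \<Rightarrow> rat mpoly list \<Rightarrow> rat mpoly list \<Rightarrow> rat mpoly list list \<Rightarrow> nat \<Rightarrow> bool" where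
  "input_code n gs hs Fs c \<longleftrightarrow> (\<exists>cg ch cF.
     c = list_encode [n, list_encode cg, list_encode ch, list_encode (map list_encode cF)] \<and>
     list_all2 (mpoly_code n) gs cg \<and>
     list_all2 (mpoly_code n) hs ch \<and>
     list_all2 (list_all2 (mpoly_code n)) Fs cF)"

definition matrix_code :: "nat \<Rightarrow> rat mpoly mat \<Rightarrow> nat \<Rightarrow> bool" where
  "matrix_code n A d \<longleftrightarrow> (\<exists>cA.
     d = list_encode [dim_row A, dim_col A, list_encode (map list_encode cA)] \<and>
     list_all2 (list_all2 (mpoly_code n)) (mat_to_list A) cA)"

lemma mpoly_code_exists:
  assumes "p \<in> mpolys n"
  shows "\<exists>c. mpoly_code n p c"
proof -
  let ?ev = "\<lambda>m. map (Poly_Mapping.lookup m) [0..<n]"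
  obtain ms where ms: "set ms = Poly_Mapping.keys p" "distinct ms"
    using finite_distinct_list[OF finite_keys[of p]] by auto
  have ev: "Poly_Mapping.nth (?ev m) = m" if "m \<in> Poly_Mapping.keys p" for m
  proof (rule poly_mapping_eqI)
    fix k
    have "Poly_Mapping.keys m \<subseteq> {..<n}"
      using assms that by (simp add: mpolys_def)
    then have "Poly_Mapping.lookup m k = 0" if "\<not> k < n"
      using that by (meson in_keys_iff lessThan_iff subsetD)
    then show "Poly_Mapping.lookup (Poly_Mapping.nth (?ev m)) k = Poly_Mapping.lookup m k"
      by (simp add: nth_default_def)
  qed
  let ?ts = "map (\<lambda>m. (Poly_Mapping.lookup p m, ?ev m)) ms"
  have "(\<Sum>t\<leftarrow>?ts. Poly_Mapping.single (Poly_Mapping.nth (snd t)) (fst t))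
      = (\<Sum>m\<leftarrow>ms. Poly_Mapping.single (Poly_Mapping.nth (?ev m)) (Poly_Mapping.lookup p m))"
    by (simp only: map_map o_def fst_conv snd_conv)
  also have "\<dots> = (\<Sum>m\<in>set ms.
      Poly_Mapping.single (Poly_Mapping.nth (?ev m)) (Poly_Mapping.lookup p m))"
    by (rule sum_list_distinct_conv_sum_set[OF ms(2)])
  also have "\<dots> = (\<Sum>m\<in>Poly_Mapping.keys p. Poly_Mapping.single m (Poly_Mapping.lookup p m))"
    by (rule sum.cong[OF ms(1)]) (simp only: ev)
  also have "\<dots> = p"
    by (rule poly_mapping_eqI) (simp add: lookup_sum lookup_single when_def in_keys_iff)
  finally have "p = (\<Sum>t\<leftarrow>?ts. Poly_Mapping.single (Poly_Mapping.nth (snd t)) (fst t))" ..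
  moreover have "\<forall>t \<in> set ?ts. length (snd t) = n"
    by simp
  ultimately show ?thesis
    unfolding mpoly_code_def by blast
qed

end

theory Submission
  imports Defs
begin

text \<open>For a word \<open>w\<close> of branches let \<open>R\<^sub>w\<close> be the row of polynomials \<open>g\<^sub>i \<circ> F\<^sub>w\<close> multiplied by the
  product of \<open>h \<circ> F\<^sub>v\<close> over all proper prefixes \<open>v\<close> of \<open>w\<close>. Then \<open>\<Sum> b\<^sub>i g\<^sub>i\<close> is an invariant of the loop
  started in \<open>a\<close> iff \<open>b\<close> is orthogonal to all \<open>R\<^sub>w(a)\<close>. Since \<open>R\<^sub>i\<^sub>w = h \<sqdot> (R\<^sub>w \<circ> F\<^sub>i)\<close>, the rows with
  \<open>length w \<le> N\<close> determine all others as soon as every row of length \<open>N + 1\<close> is a \<open>\<rat>[x]\<close>-linear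
  combination of them. Hilbert's basis theorem for \<open>\<rat>[x]\<^sup>m\<close> says that such an \<open>N\<close> exists, so an
  unbounded search over \<open>N\<close> and the coefficients of the combinations terminates, and each candidate
  is checked by polynomial arithmetic.\<close>

section \<open>Partial recursive functions on coded data\<close>

text \<open>The factors \<open>h\<close> make the stopping rule linear in \<open>b\<close>: over a
  field a product vanishes iff a factor does, so orthogonality to the row of a word says that the
  run along this word stopped before its end or that the combination vanishes at its end. A single
  stabilising step suffices because it holds at all starting points at once. The cofactor relation
  is an identity of polynomials, so it may be evaluated at \<open>a\<close> and at every point that
  the loop reaches from \<open>a\<close>; for the same reason one matrix serves all
  \<open>a\<close>. Neither a Groebner basis nor a decision procedure for module membership occurs.
  Guessing cofactors only confirms membership, and this is enough, since the search may halt at any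
  correct certificate, not only at the least \<open>N\<close>. The program runs on term lists rather
  than on polynomials. The input has no normal form, products and substitutions repeat monomials,
  and coefficients are collected only when a list is tested for zero.\<close>

lemma computes_Comp1:
  "computes g xs y \<Longrightarrow> computes f [y] z \<Longrightarrow> computes (Comp f [g]) xs z"
  by (rule computes.comp[where ys = "[y]"]) auto

lemma computes_Comp2:
  "computes g xs y \<Longrightarrow> computes g' xs y' \<Longrightarrow> computes f [y, y'] z \<Longrightarrow> computes (Comp f [g, g']) xs z"
  by (rule computes.comp[where ys = "[y, y']"]) auto

lemma computes_Proj: "i < length xs \<Longrightarrow> y = xs ! i \<Longrightarrow> computes (Proj i) xs y"
  using computes.proj by blast

lemma computes_Succ: "computes g xs y \<Longrightarrow> computes (Comp Succ [g]) xs (Suc y)"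
  by (rule computes_Comp1) (auto intro: computes.succ)

lemma computes_PrimRec:
  assumes "computes f xs (a 0)" and "\<And>n. computes g (n # a n # xs) (a (Suc n))"
  shows "computes (PrimRec f g) (n # xs) (a n)"
  by (induction n) (auto intro: computes.primrec_0 computes.primrec_Suc assms)

text \<open>\<open>computes.mu\<close> asks for a positive result at every argument below the
  minimum, so the test must terminate everywhere; \<open>t\<close> records its values.\<close>

lemma computes_Mu_Least:
  fixes t :: "nat \<Rightarrow> nat"
  assumes "\<And>n. computes f (n # xs) (t n)" and "t n = 0"
  shows "computes (Mu f) xs (LEAST n. t n = 0)"
proof (rule computes.mu)
  show "computes f ((LEAST n. t n = 0) # xs) 0"
    using assms(1)[of "LEAST n. t n = 0"] LeastI[of "\<lambda>n. t n = 0", OF assms(2)] by simp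
  show "\<forall>i<LEAST n. t n = 0. \<exists>y. computes f (i # xs) (Suc y)"
  proof (intro allI impI)
    fix i assume "i < (LEAST n. t n = 0)"
    then have "t i \<noteq> 0" by (rule not_less_Least)
    then show "\<exists>y. computes f (i # xs) (Suc y)"
      using assms(1)[of i] by (metis not0_implies_Suc)
  qed
qed

definition pred_recf :: recf where
  "pred_recf = PrimRec Zero (Proj 0)"

definition add_recf :: recf where
  "add_recf = PrimRec (Proj 0) (Comp Succ [Proj 1])"

text \<open>Recursion runs on the first argument, so the subtrahend comes first.\<close>

definition monus_recf :: recf where
  "monus_recf = PrimRec (Proj 0) (Comp pred_recf [Proj 1])"

definition triangle_recf :: recf where
  "triangle_recf = PrimRec Zero (Comp add_recf [Proj 1, Comp Succ [Proj 0]])"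

definition pair_recf :: recf where
  "pair_recf = Comp add_recf [Comp triangle_recf [add_recf], Proj 0]"

definition root_recf :: recf where
  "root_recf = Mu (Comp monus_recf [Comp triangle_recf [Comp Succ [Proj 0]], Comp Succ [Proj 1]])"

text \<open>The code of \<open>(m, n)\<close> is \<open>triangle (m + n) + m\<close> and its root is
  \<open>m + n\<close>: removing the triangular number leaves \<open>m\<close>, and removing
  \<open>m\<close> from the root leaves \<open>n\<close>.\<close>

definition fst_recf :: recf where
  "fst_recf = Comp monus_recf [Comp triangle_recf [root_recf], Proj 0]"

definition snd_recf :: recf where
  "snd_recf = Comp monus_recf [fst_recf, root_recf]"

lemma computes_pred_recf: "computes pred_recf [n] (n - 1)"
  unfolding pred_recf_def
  by (rule computes_PrimRec[where a = "\<lambda>n. n - 1"]) (auto intro: computes.zero computes_Proj)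

lemma computes_add_recf: "computes add_recf [m, n] (m + n)"
  unfolding add_recf_def
  by (rule computes_PrimRec[where a = "\<lambda>m. m + n"])
    (auto intro!: computes_Succ computes_Proj)

lemma computes_monus_recf: "computes monus_recf [m, n] (n - m)"
  unfolding monus_recf_def
proof (rule computes_PrimRec[where a = "\<lambda>m. n - m"])
  show "computes (Comp pred_recf [Proj 1]) [k, n - k, n] (n - Suc k)" for k
    by (rule computes_Comp1[where y = "n - k"])
      (use computes_pred_recf[of "n - k"] in \<open>auto intro: computes_Proj\<close>)
qed (auto intro: computes_Proj)

lemma computes_triangle_recf: "computes triangle_recf [n] (triangle n)"
  unfolding triangle_recf_def
proof (rule computes_PrimRec[where a = triangle])
  show "computes (Comp add_recf [Proj 1, Comp Succ [Proj 0]]) [k, triangle k] (triangle (Suc k))" for k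
    using computes_add_recf[of "triangle k" "Suc k"]
    by (intro computes_Comp2[where y = "triangle k" and y' = "Suc k"])
      (auto intro!: computes_Proj computes_Succ)
qed (simp add: computes.zero)

lemma computes_pair_recf: "computes pair_recf [m, n] (prod_encode (m, n))"
proof -
  have "computes (Comp triangle_recf [add_recf]) [m, n] (triangle (m + n))"
    by (rule computes_Comp1[OF computes_add_recf computes_triangle_recf])
  then show ?thesis
    unfolding pair_recf_def prod_encode_def split
    by (rule computes_Comp2[OF _ computes_Proj computes_add_recf]) auto
qed

text \<open>The sum of the components of a pair is recovered from its code \<open>z\<close> as the least \<open>s\<close>
  with \<open>z < triangle (Suc s)\<close>.\<close>

lemma computes_root_recf: "computes root_recf [prod_encode (m, n)] (m + n)"
proof -
  let ?z = "prod_encode (m, n)"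
  let ?t = "\<lambda>s. Suc ?z - triangle (Suc s)"
  have mono: "mono triangle"
    by (rule mono_iff_le_Suc[THEN iffD2]) simp
  have "?t (m + n) = 0"
    by (simp add: prod_encode_def)
  have "(LEAST s. ?t s = 0) = m + n"
  proof (rule Least_equality)
    show "?t (m + n) = 0" by fact
    fix s assume "?t s = 0"
    show "m + n \<le> s"
    proof (rule ccontr)
      assume "\<not> m + n \<le> s"
      then have "triangle (Suc s) \<le> triangle (m + n)" by (intro monoD[OF mono]) simp
      with \<open>?t s = 0\<close> show False by (simp add: prod_encode_def)
    qed
  qed
  moreover have "computes root_recf [?z] (LEAST s. ?t s = 0)"
    unfolding root_recf_def
  proof (rule computes_Mu_Least)
    fix s
    have "computes (Comp triangle_recf [Comp Succ [Proj 0]]) [s, ?z] (triangle (Suc s))"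
      by (rule computes_Comp1[OF _ computes_triangle_recf]) (auto intro!: computes_Succ computes_Proj)
    then show "computes (Comp monus_recf [Comp triangle_recf [Comp Succ [Proj 0]], Comp Succ [Proj 1]])
        [s, ?z] (?t s)"
      by (rule computes_Comp2[OF _ _ computes_monus_recf]) (auto intro!: computes_Succ computes_Proj)
  qed fact
  ultimately show ?thesis by simp
qed

lemma computes_fst_recf: "computes fst_recf [prod_encode (m, n)] m"
proof -
  have "computes (Comp triangle_recf [root_recf]) [prod_encode (m, n)] (triangle (m + n))"
    by (rule computes_Comp1[OF computes_root_recf computes_triangle_recf])
  then have "computes fst_recf [prod_encode (m, n)] (prod_encode (m, n) - triangle (m + n))"
    unfolding fst_recf_def
    by (rule computes_Comp2[OF _ computes_Proj computes_monus_recf]) auto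
  then show ?thesis by (simp add: prod_encode_def)
qed

lemma computes_snd_recf: "computes snd_recf [prod_encode (m, n)] n"
  using computes_Comp2[OF computes_fst_recf computes_root_recf computes_monus_recf, of m n]
  unfolding snd_recf_def by simp


section \<open>Typed encodings and total computable functions\<close>

class enc =
  fixes enc :: "'a \<Rightarrow> nat"
  assumes enc_inj: "enc x = enc y \<Longrightarrow> x = y"

instantiation nat :: enc
begin
definition enc_nat :: "nat \<Rightarrow> nat" where "enc_nat n = n"
instance by standard (simp add: enc_nat_def)
end

instantiation bool :: enc
begin
definition enc_bool :: "bool \<Rightarrow> nat" where "enc_bool b = (if b then 1 else 0)"
instance by standard (simp add: enc_bool_def split: if_splits)
end

instantiation int :: enc
begin
definition enc_int :: "int \<Rightarrow> nat" where "enc_int = int_encode"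
instance by standard (simp add: enc_int_def int_encode_eq)
end

instantiation prod :: (enc, enc) enc
begin
definition enc_prod :: "'a \<times> 'b \<Rightarrow> nat" where "enc_prod p = prod_encode (enc (fst p), enc (snd p))"
instance by standard (auto simp: enc_prod_def prod_eq_iff dest: enc_inj)
end

instantiation list :: (enc) enc
begin
definition enc_list :: "'a list \<Rightarrow> nat" where "enc_list xs = list_encode (map enc xs)"
instance by standard (auto simp: enc_list_def list_encode_eq list.inj_map_strong dest: enc_inj intro!: list.inj_map_strong[of _ _ enc enc])
end

instantiation rat :: enc
begin
definition enc_rat :: "rat \<Rightarrow> nat" where "enc_rat = rat_code"
instance
proof
  fix p q :: rat
  assume "enc p = enc q"
  then have "fst (quotient_of p) = fst (quotient_of q)" "nat (snd (quotient_of p)) = nat (snd (quotient_of q))"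
    by (auto simp: enc_rat_def rat_code_def int_encode_eq split: prod.splits)
  moreover have "snd (quotient_of p) > 0" "snd (quotient_of q) > 0"
    using quotient_of_denom_pos' by auto
  ultimately have "quotient_of p = quotient_of q"
    by (simp add: prod_eq_iff)
  then show "p = q" by (rule quotient_of_inject)
qed
end

lemma enc_Pair: "enc (x, y) = prod_encode (enc x, enc y)"
  by (simp add: enc_prod_def)

lemma enc_Nil: "enc [] = 0"
  by (simp add: enc_list_def)

lemma enc_Cons: "enc (x # xs) = Suc (enc (x, xs))"
  by (simp add: enc_list_def enc_prod_def)

text \<open>Nothing is demanded on numbers that encode no value, so programs only have to be right
  on codes of well-typed arguments.\<close>

definition computable :: "('a::enc \<Rightarrow> 'b::enc) \<Rightarrow> bool" where
  "computable f \<longleftrightarrow> (\<exists>e. \<forall>x. computes e [enc x] (enc (f x)))"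

lemma computableI: "(\<And>x. computes e [enc x] (enc (f x))) \<Longrightarrow> computable f"
  unfolding computable_def by blast

lemma computableE:
  assumes "computable f"
  obtains e where "\<And>x. computes e [enc x] (enc (f x))"
  using assms unfolding computable_def by blast

named_theorems computable_intros

lemma computable_id [computable_intros]: "computable (\<lambda>x. x)"
  by (rule computableI[of "Proj 0"]) (auto intro: computes_Proj)

lemma computable_const [computable_intros]: "computable (\<lambda>x. c)"
proof -
  have "\<exists>e. \<forall>xs. computes e xs n" for n
    by (induction n) (auto intro: computes.zero computes_Succ)
  then show ?thesis
    unfolding computable_def by blast
qed

lemma computable_comp:
  assumes "computable f" "computable g"
  shows "computable (\<lambda>x. f (g x))"
proof -
  from assms obtain e e' where "\<And>x. computes e [enc x] (enc (f x))" "\<And>x. computes e' [enc x] (enc (g x))"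
    by (metis computableE)
  then show ?thesis
    by (intro computableI[of "Comp e [e']"]) (rule computes_Comp1)
qed

lemma computable_same_code:
  assumes "computable f" "\<And>x. enc (g x) = enc (f x)"
  shows "computable g"
  using assms unfolding computable_def by simp

text \<open>Changes the type of the argument without touching its code. The typed search uses it to
  read the number under test as the code of a candidate.\<close>

lemma computable_reinterpret:
  assumes "computable f" "\<And>x. enc x = enc (h x)" "\<And>x. enc (g x) = enc (f (h x))"
  shows "computable g"
  using assms unfolding computable_def by metis

lemma computable_Pair [computable_intros]:
  assumes "computable f" "computable g"
  shows "computable (\<lambda>x. (f x, g x))"
proof -
  from assms obtain e e' where "\<And>x. computes e [enc x] (enc (f x))" "\<And>x. computes e' [enc x] (enc (g x))"
    by (metis computableE)
  then show ?thesis
    unfolding enc_Pair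
    by (intro computableI[of "Comp pair_recf [e, e']"])
      (auto simp: enc_Pair intro: computes_Comp2 computes_pair_recf)
qed

lemma computable_fst [computable_intros]:
  assumes "computable f"
  shows "computable (\<lambda>x. fst (f x))"
proof (rule computable_comp[OF _ assms])
  show "computable (fst :: 'b \<times> 'c \<Rightarrow> 'b)"
    by (rule computableI[of fst_recf]) (auto simp: enc_prod_def intro: computes_fst_recf)
qed

lemma computable_snd [computable_intros]:
  assumes "computable f"
  shows "computable (\<lambda>x. snd (f x))"
proof (rule computable_comp[OF _ assms])
  show "computable (snd :: 'b \<times> 'c \<Rightarrow> 'c)"
    by (rule computableI[of snd_recf]) (auto simp: enc_prod_def intro: computes_snd_recf)
qed

lemma computable_comp2:
  assumes "computable (\<lambda>z. F (fst z) (snd z))" "computable f" "computable g"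
  shows "computable (\<lambda>x. F (f x) (g x))"
  using computable_comp[OF assms(1) computable_Pair[OF assms(2,3)]] by simp

lemma computable_comp3:
  assumes "computable (\<lambda>z. F (fst z) (fst (snd z)) (snd (snd z)))" "computable f" "computable g" "computable h"
  shows "computable (\<lambda>x. F (f x) (g x) (h x))"
  using computable_comp[OF assms(1) computable_Pair[OF assms(2) computable_Pair[OF assms(3,4)]]] by simp

text \<open>The binder rules have a premise over an extended environment: \<open>fst z\<close> is the old environment
  and \<open>snd z\<close> holds the bound variables.\<close>

lemma computable_rec_nat [computable_intros]:
  assumes "computable (\<lambda>z. g (fst z) (fst (snd z)) (snd (snd z)))" "computable f" "computable k"
  shows "computable (\<lambda>x. rec_nat (f x) (g x) (k x))"
proof -
  from assms(2) obtain ef where ef: "\<And>x. computes ef [enc x] (enc (f x))"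
    unfolding computable_def by blast
  from assms(3) obtain ek where ek: "\<And>x. computes ek [enc x] (enc (k x))"
    unfolding computable_def by blast
  from assms(1) obtain eg where
    eg: "\<And>z. computes eg [enc z] (enc (g (fst z) (fst (snd z)) (snd (snd z))))"
    unfolding computable_def by blast
  \<comment> \<open>\<open>PrimRec\<close> supplies counter, previous value and parameter, while
    \<open>eg\<close> expects the environment in front of the two bound values.\<close>
  define step where "step = Comp eg [Comp pair_recf [Proj 2, Comp pair_recf [Proj 0, Proj 1]]]"
  have step: "computes step [n, enc r, enc x] (enc (g x n r))" for n r x
  proof -
    have "computes (Comp pair_recf [Proj 0, Proj 1]) [n, enc r, enc x] (enc (n, r))"
      unfolding enc_Pair enc_nat_def
      by (rule computes_Comp2[OF _ _ computes_pair_recf]) (auto intro: computes_Proj)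
    then have "computes (Comp pair_recf [Proj 2, Comp pair_recf [Proj 0, Proj 1]]) [n, enc r, enc x] (enc (x, n, r))"
      unfolding enc_Pair[of x]
      by (rule computes_Comp2[OF _ _ computes_pair_recf, rotated]) (auto intro: computes_Proj)
    then show ?thesis
      unfolding step_def using eg[of "(x, n, r)"] by (auto intro: computes_Comp1)
  qed
  have "computes (PrimRec ef step) [n, enc x] (enc (rec_nat (f x) (g x) n))" for n x
    by (rule computes_PrimRec[where a = "\<lambda>n. enc (rec_nat (f x) (g x) n)"]) (auto intro: ef step)
  then show ?thesis
    using ek by (intro computableI[of "Comp (PrimRec ef step) [ek, Proj 0]"])
      (auto simp: enc_nat_def intro!: computes_Comp2 computes_Proj)
qed

lemma funpow_eq_rec_nat: "(f ^^ n) x = rec_nat x (\<lambda>_. f) n"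
  by (induction n) auto

lemma computable_funpow [computable_intros]:
  fixes g :: "'a::enc \<Rightarrow> 'b::enc \<Rightarrow> 'b"
  assumes "computable (\<lambda>z. g (fst z) (snd z))" "computable k" "computable f"
  shows "computable (\<lambda>x. (g x ^^ k x) (f x))"
proof -
  have "computable (\<lambda>z. g (fst z) (snd (snd z)))"
    by (rule computable_comp2[OF assms(1)]) (intro computable_intros)+
  then show ?thesis
    unfolding funpow_eq_rec_nat by (intro computable_rec_nat assms)
qed

lemma computable_Suc [computable_intros]:
  assumes "computable f"
  shows "computable (\<lambda>x. Suc (f x))"
  by (rule computable_comp[OF _ assms], rule computableI[of Succ]) (auto simp: enc_nat_def intro: computes.succ)

lemma computable_If [computable_intros]:
  assumes "computable b" "computable f" "computable g"
  shows "computable (\<lambda>x. if b x then f x else g x)"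
proof -
  have "computable (\<lambda>x. enc (b x))"
    by (rule computable_same_code[OF assms(1)]) (simp add: enc_nat_def)
  then have "computable (\<lambda>x. rec_nat (g x) (\<lambda>_ _. f x) (enc (b x)))"
    by (intro computable_rec_nat computable_comp[OF assms(2)] assms computable_intros)
  moreover have "rec_nat (g x) (\<lambda>_ _. f x) (enc (b x)) = (if b x then f x else g x)" for x
    by (simp add: enc_bool_def)
  ultimately show ?thesis by simp
qed

text \<open>Recursion runs on the sign of the code: no step for the empty list, exactly one
  otherwise. That step ignores counter and previous value; the code of a nonempty list is the
  successor of a pair code, so the predecessor gives head and tail.\<close>

lemma computable_case_list [computable_intros]:
  assumes "computable (\<lambda>z. g (fst z) (fst (snd z)) (snd (snd z)))" "computable f" "computable l"
  shows "computable (\<lambda>x. case l x of [] \<Rightarrow> f x | y # ys \<Rightarrow> g x y ys)"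
proof -
  from assms(2) obtain ef where ef: "\<And>x. computes ef [enc x] (enc (f x))"
    unfolding computable_def by blast
  from assms(3) obtain el where el: "\<And>x. computes el [enc x] (enc (l x))"
    unfolding computable_def by blast
  from assms(1) obtain eg where
    eg: "\<And>z. computes eg [enc z] (enc (g (fst z) (fst (snd z)) (snd (snd z))))"
    unfolding computable_def by blast
  define sgn_recf where "sgn_recf = PrimRec Zero (Comp Succ [Zero])"
  have sgn: "computes sgn_recf [n] (if n = 0 then 0 else 1)" for n
    unfolding sgn_recf_def
    by (rule computes_PrimRec[where a = "\<lambda>n. if n = 0 then 0 else 1"])
      (use computes_Succ[OF computes.zero] in \<open>auto intro: computes.zero\<close>)
  have el': "computes (Comp el [Proj 2]) [n, r, enc x] (enc (l x))" for n r x
    by (rule computes_Comp1[OF _ el]) (auto intro: computes_Proj)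
  define step where "step = Comp eg [Comp pair_recf [Proj 2, Comp pred_recf [Comp el [Proj 2]]]]"
  have step: "computes step [n, r, enc x] (enc (g x y ys))" if "l x = y # ys" for n r x y ys
  proof -
    have "computes (Comp pred_recf [Comp el [Proj 2]]) [n, r, enc x] (enc (y, ys))"
      using computes_pred_recf[of "enc (l x)"] el'[of n r x] that
      by (auto simp: enc_Cons intro: computes_Comp1)
    then have "computes (Comp pair_recf [Proj 2, Comp pred_recf [Comp el [Proj 2]]]) [n, r, enc x] (enc (x, y, ys))"
      unfolding enc_Pair[of x]
      by (rule computes_Comp2[OF _ _ computes_pair_recf, rotated]) (auto intro: computes_Proj)
    then show ?thesis
      unfolding step_def using eg[of "(x, y, ys)"] by (auto intro: computes_Comp1)
  qed
  show ?thesis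
  proof (rule computableI[of "Comp (PrimRec ef step) [Comp sgn_recf [el], Proj 0]"])
    fix x
    let ?s = "if enc (l x) = 0 then 0 else 1 :: nat"
    have 1: "computes (Comp sgn_recf [el]) [enc x] ?s"
      by (rule computes_Comp1[OF el sgn])
    have 2: "computes (PrimRec ef step) [?s, enc x] (enc (case l x of [] \<Rightarrow> f x | y # ys \<Rightarrow> g x y ys))"
    proof (cases "l x")
      case Nil
      then show ?thesis by (auto simp: enc_Nil intro: computes.primrec_0 ef)
    next
      case (Cons y ys)
      then show ?thesis
        by (auto simp: enc_Cons intro!: computes.primrec_Suc computes.primrec_0 ef step)
    qed
    show "computes (Comp (PrimRec ef step) [Comp sgn_recf [el], Proj 0]) [enc x]
        (enc (case l x of [] \<Rightarrow> f x | y # ys \<Rightarrow> g x y ys))"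
      by (rule computes_Comp2[OF 1 computes_Proj 2]) auto
  qed
qed


section \<open>Natural numbers, bounded iteration and lists\<close>

lemma computable_code [computable_intros]:
  assumes "computable f"
  shows "computable (\<lambda>x. enc (f x))"
  by (rule computable_same_code[OF assms]) (simp add: enc_nat_def)

lemma computable_add_nat [computable_intros]:
  fixes f g :: "'a::enc \<Rightarrow> nat"
  assumes "computable f" "computable g"
  shows "computable (\<lambda>x. f x + g x)"
proof -
  have *: "m + n = rec_nat n (\<lambda>_ r. Suc r) m" for m n :: nat
    by (induction m) auto
  show ?thesis
    unfolding * by (intro computable_intros assms)
qed

lemma computable_diff_nat [computable_intros]:
  fixes f g :: "'a::enc \<Rightarrow> nat"
  assumes "computable f" "computable g"
  shows "computable (\<lambda>x. f x - g x)"
proof -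
  \<comment> \<open>The inner \<open>rec_nat\<close> is the predecessor function.\<close>
  have *: "m - n = rec_nat m (\<lambda>_ r. rec_nat 0 (\<lambda>k _. k) r) n" for m n :: nat
  proof (induction n)
    case (Suc n)
    have "m - Suc n = m - n - 1" by simp
    also have "\<dots> = rec_nat 0 (\<lambda>k _. k) (m - n)" by (cases "m - n") auto
    finally show ?case by (simp add: Suc.IH)
  qed simp
  show ?thesis
    unfolding * by (intro computable_intros assms)
qed

lemma computable_mult_nat [computable_intros]:
  fixes f g :: "'a::enc \<Rightarrow> nat"
  assumes "computable f" "computable g"
  shows "computable (\<lambda>x. f x * g x)"
proof -
  have *: "m * n = rec_nat 0 (\<lambda>_ r. n + r) m" for m n :: nat
    by (induction m) auto
  have "computable (\<lambda>z. g (fst z))"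
    by (intro computable_comp[OF assms(2)] computable_intros)
  then show ?thesis
    unfolding * by (intro computable_intros assms)
qed

lemma computable_eq_0 [computable_intros]:
  fixes f :: "'a::enc \<Rightarrow> nat"
  assumes "computable f"
  shows "computable (\<lambda>x. f x = 0)"
proof -
  have *: "(n = 0) = rec_nat True (\<lambda>_ _. False) n" for n
    by (cases n) auto
  show ?thesis
    unfolding * by (intro computable_intros assms)
qed

lemma computable_le_nat [computable_intros]:
  fixes f g :: "'a::enc \<Rightarrow> nat"
  assumes "computable f" "computable g"
  shows "computable (\<lambda>x. f x \<le> g x)"
proof -
  have *: "m \<le> n \<longleftrightarrow> m - n = 0" for m n :: nat
    by simp
  show ?thesis
    unfolding * by (intro computable_eq_0 computable_diff_nat assms)
qed

lemma computable_less_nat [computable_intros]: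
  fixes f g :: "'a::enc \<Rightarrow> nat"
  assumes "computable f" "computable g"
  shows "computable (\<lambda>x. f x < g x)"
  unfolding less_eq_Suc_le by (intro computable_intros assms)

text \<open>Injectivity of \<open>enc\<close> reduces equality in any type to the vanishing of both
  truncated differences of the codes.\<close>

lemma computable_eq [computable_intros]:
  assumes "computable f" "computable g"
  shows "computable (\<lambda>x. f x = g x)"
proof -
  have *: "y = z \<longleftrightarrow> (enc y - enc z) + (enc z - enc y) = 0" for y z :: 'b
    by (auto dest: enc_inj)
  show ?thesis
    unfolding * by (intro computable_intros assms)
qed

lemma computable_conj [computable_intros]:
  assumes "computable f" "computable g"
  shows "computable (\<lambda>x. f x \<and> g x)"
proof -
  have *: "b \<and> c \<longleftrightarrow> (if b then c else False)" for b c
    by simp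
  show ?thesis
    unfolding * by (intro computable_If computable_const assms)
qed

text \<open>The search halts only where a witness exists, so the conclusion is a program with a
  conditional specification instead of \<open>computable\<close>.\<close>

lemma computable_search:
  assumes "computable (\<lambda>z. P (fst z) (snd z))"
  obtains e where "\<And>x n. P x n \<Longrightarrow> computes e [enc x] (LEAST n. P x n)"
proof -
  have "computable (\<lambda>z. if P (fst z) (snd z) then 0 else 1 :: nat)"
    by (intro computable_If computable_const assms)
  then obtain e where e: "\<And>z. computes e [enc z] (if P (fst z) (snd z) then 0 else 1)"
    unfolding computable_def enc_nat_def by blast
  have "computes (Mu (Comp e [Comp pair_recf [Proj 1, Proj 0]])) [enc x] (LEAST n. P x n)"
    if "P x n" for x n
  proof -
    have "computes (Comp e [Comp pair_recf [Proj 1, Proj 0]]) [n, enc x] (if P x n then 0 else 1)" for n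
    proof -
      have "computes (Comp pair_recf [Proj 1, Proj 0]) [n, enc x] (enc (x, n))"
        unfolding enc_Pair enc_nat_def
        by (rule computes_Comp2[OF _ _ computes_pair_recf]) (auto intro: computes_Proj)
      then show ?thesis
        using e[of "(x, n)"] by (auto intro: computes_Comp1)
    qed
    from computes_Mu_Least[OF this, of n] that
    show ?thesis by (simp split: if_splits)
  qed
  with that show ?thesis by blast
qed

lemma computable_Least [computable_intros]:
  fixes P :: "'a::enc \<Rightarrow> nat \<Rightarrow> bool"
  assumes "computable (\<lambda>z. P (fst z) (snd z))" "\<And>x. \<exists>n. P x n"
  shows "computable (\<lambda>x. LEAST n. P x n)"
proof -
  obtain e where e: "\<And>x n. P x n \<Longrightarrow> computes e [enc x] (LEAST n. P x n)"
    using computable_search[OF assms(1)] by blast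
  then show ?thesis
    using assms(2) by (intro computableI[of e]) (metis e enc_nat_def)
qed

lemma computable_div_nat [computable_intros]:
  fixes f g :: "'a::enc \<Rightarrow> nat"
  assumes "computable f" "computable g"
  shows "computable (\<lambda>x. f x div g x)"
proof -
  \<comment> \<open>The disjunct \<open>n = 0\<close> keeps the search total and yields 0, the value
    of \<open>div\<close> in that case.\<close>
  have *: "m div n = (LEAST q. n = 0 \<or> m < n * Suc q)" for m n :: nat
  proof (rule Least_equality[symmetric])
    show "n = 0 \<or> m < n * Suc (m div n)"
      using dividend_less_times_div[of n m] by auto
    show "m div n \<le> q" if "n = 0 \<or> m < n * Suc q" for q
    proof (cases "n = 0")
      case False
      with that have "m div n < Suc q"
        by (simp add: less_mult_imp_div_less mult.commute)
      then show ?thesis by simp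
    qed simp
  qed
  have **: "n = 0 \<or> m < n * Suc q \<longleftrightarrow> (if n = 0 then True else m < n * Suc q)" for m n q :: nat
    by simp
  show ?thesis
    unfolding * **
  proof (intro computable_Least computable_If computable_less_nat computable_mult_nat computable_eq_0
      computable_comp[OF assms(1) computable_fst] computable_comp[OF assms(2) computable_fst] computable_intros)
    show "\<exists>q. if g x = 0 then True else f x < g x * Suc q" for x
      using dividend_less_times_div[of "g x" "f x"] by auto
  qed
qed

lemma computable_Cons [computable_intros]:
  assumes "computable f" "computable g"
  shows "computable (\<lambda>x. f x # g x)"
proof -
  have "computable (\<lambda>x. Suc (enc (f x, g x)))"
    by (intro computable_intros assms)
  then show ?thesis
    by (rule computable_same_code) (simp add: enc_Cons enc_nat_def)
qed

lemma length_le_enc: "length xs \<le> enc xs"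
proof (induction xs)
  case (Cons x xs)
  have "enc xs \<le> enc (x, xs)"
    by (simp add: enc_Pair le_prod_encode_2)
  with Cons show ?case by (simp add: enc_Cons)
qed simp

text \<open>A state whose list is exhausted is a fixed point, so surplus iterations do no harm and
  the code of the list, which bounds its length, can serve as the number of iterations.\<close>

lemma funpow_fold:
  assumes "length xs \<le> n"
  shows "((\<lambda>z. case fst z of [] \<Rightarrow> z | y # ys \<Rightarrow> (ys, g y (snd z))) ^^ n) (xs, s) = ([], fold g xs s)"
  using assms
proof (induction n arbitrary: xs s)
  case (Suc n)
  then show ?case
    by (cases xs) (simp_all del: funpow.simps add: funpow_Suc_right)
qed simp

lemma computable_fold [computable_intros]:
  assumes "computable (\<lambda>z. g (fst z) (fst (snd z)) (snd (snd z)))" "computable l" "computable s"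
  shows "computable (\<lambda>x. fold (g x) (l x) (s x))"
proof -
  have *: "fold g l s =
      snd (((\<lambda>z. case fst z of [] \<Rightarrow> z | y # ys \<Rightarrow> (ys, g y (snd z))) ^^ enc l) (l, s))"
    for g :: "'b \<Rightarrow> 'c \<Rightarrow> 'c" and l s
    by (simp add: funpow_fold length_le_enc)
  have "computable (\<lambda>z. g (fst (fst z)) (fst (snd z)) (snd (snd (fst z))))"
    by (rule computable_comp3[OF assms(1)]) (intro computable_intros)+
  then show ?thesis
    unfolding * by (intro computable_intros assms)
qed

lemma computable_rev [computable_intros]:
  assumes "computable l"
  shows "computable (\<lambda>x. rev (l x))"
  unfolding rev_conv_fold by (intro computable_intros assms)

lemma computable_map [computable_intros]:
  assumes "computable (\<lambda>z. f (fst z) (snd z))" "computable l"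
  shows "computable (\<lambda>x. map (f x) (l x))"
proof -
  have *: "map f l = rev (fold (\<lambda>y r. f y # r) l [])" for f :: "'b \<Rightarrow> 'c" and l
  proof -
    have "fold (\<lambda>y r. f y # r) l r = rev (map f l) @ r" for r
      by (induction l arbitrary: r) auto
    then show ?thesis by simp
  qed
  show ?thesis
    unfolding * by (intro computable_intros computable_comp2[OF assms(1)] assms(2))
qed

lemma computable_append [computable_intros]:
  assumes "computable f" "computable g"
  shows "computable (\<lambda>x. f x @ g x)"
proof -
  have *: "xs @ ys = fold Cons (rev xs) ys" for xs ys :: "'b list"
    by (simp add: fold_Cons_rev)
  show ?thesis
    unfolding * by (intro computable_intros assms)
qed

lemma computable_concat [computable_intros]:
  assumes "computable l"
  shows "computable (\<lambda>x. concat (l x))"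
proof -
  have *: "concat l = fold (\<lambda>y r. r @ y) l []" for l :: "'b list list"
  proof -
    have "fold (\<lambda>y r. r @ y) l r = r @ concat l" for r
      by (induction l arbitrary: r) auto
    then show ?thesis by simp
  qed
  show ?thesis
    unfolding * by (intro computable_intros assms)
qed

lemma computable_length [computable_intros]:
  assumes "computable l"
  shows "computable (\<lambda>x. length (l x))"
proof -
  have *: "length l = fold (\<lambda>_ r. Suc r) l 0" for l :: "'b list"
  proof -
    have "fold (\<lambda>_ r. Suc r) l r = length l + r" for r
      by (induction l arbitrary: r) auto
    then show ?thesis by simp
  qed
  show ?thesis
    unfolding * by (intro computable_intros assms)
qed

lemma computable_list_all [computable_intros]:
  assumes "computable (\<lambda>z. P (fst z) (snd z))" "computable l"
  shows "computable (\<lambda>x. list_all (P x) (l x))"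
proof -
  have *: "list_all P l = fold (\<lambda>y r. r \<and> P y) l True" for P :: "'b \<Rightarrow> bool" and l
  proof -
    have "fold (\<lambda>y r. r \<and> P y) l r = (r \<and> list_all P l)" for r
      by (induction l arbitrary: r) auto
    then show ?thesis by simp
  qed
  show ?thesis
    unfolding * by (intro computable_intros computable_comp2[OF assms(1)] assms(2))
qed

lemma computable_list_ex [computable_intros]:
  assumes "computable (\<lambda>z. P (fst z) (snd z))" "computable l"
  shows "computable (\<lambda>x. list_ex (P x) (l x))"
proof -
  have *: "list_ex P l = fold (\<lambda>y r. if P y then True else r) l False" for P :: "'b \<Rightarrow> bool" and l
  proof -
    have "fold (\<lambda>y r. if P y then True else r) l r = (r \<or> list_ex P l)" for r
      by (induction l arbitrary: r) auto
    then show ?thesis by simp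
  qed
  show ?thesis
    unfolding * by (intro computable_intros computable_comp2[OF assms(1)] assms(2))
qed

lemma computable_zip [computable_intros]:
  assumes "computable f" "computable g"
  shows "computable (\<lambda>x. zip (f x) (g x))"
proof -
  have *: "zip xs ys =
      rev (snd (fold (\<lambda>x z. case fst z of [] \<Rightarrow> z | y # ys \<Rightarrow> (ys, (x, y) # snd z)) xs (ys, [])))"
    for xs :: "'b list" and ys :: "'c list"
  proof -
    have "snd (fold (\<lambda>x z. case fst z of [] \<Rightarrow> z | y # ys \<Rightarrow> (ys, (x, y) # snd z)) xs (ys, r))
        = rev (zip xs ys) @ r" for r
    proof (induction xs arbitrary: ys r)
      case (Cons x xs)
      then show ?case by (cases ys) auto
    qed simp
    then show ?thesis by simp
  qed
  show ?thesis
    unfolding * by (intro computable_intros assms)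
qed

lemma computable_replicate [computable_intros]:
  assumes "computable k" "computable f"
  shows "computable (\<lambda>x. replicate (k x) (f x))"
proof -
  have *: "replicate n y = rec_nat [] (\<lambda>_ r. y # r) n" for n and y :: 'b
    by (induction n) auto
  show ?thesis
    unfolding * by (intro computable_intros computable_comp[OF assms(2) computable_fst] assms)
qed

section \<open>Integer and rational arithmetic\<close>

lemma enc_int_nonneg: "enc (int n) = 2 * n"
  by (simp add: enc_int_def int_encode_def sum_encode_def)

text \<open>Truncated subtraction makes \<open>2 * n - 1\<close> the correct code of \<open>- n\<close> also for \<open>n = 0\<close>.\<close>

lemma enc_int_nonpos: "enc (- int n) = 2 * n - 1"
  by (cases n) (auto simp: enc_int_def int_encode_def sum_encode_def)

text \<open>Nonnegative integers have even codes and negative ones odd codes, so parity decides the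
  sign and halving recovers the absolute value, up to an offset of one for odd codes.\<close>

lemma computable_nat [computable_intros]:
  assumes "computable f"
  shows "computable (\<lambda>x. nat (f x))"
proof -
  have *: "nat i = (if enc i = 2 * (enc i div 2) then enc i div 2 else 0)" for i
    by (cases i rule: int_cases2)
      (auto simp: enc_int_nonneg enc_int_nonpos, presburger)
  show ?thesis
    unfolding * by (intro computable_intros assms)
qed

lemma computable_nat_minus [computable_intros]:
  assumes "computable f"
  shows "computable (\<lambda>x. nat (- f x))"
proof -
  have *: "nat (- i) = (if enc i = 2 * (enc i div 2) then 0 else Suc (enc i div 2))" for i
    by (cases i rule: int_cases2)
      (auto simp: enc_int_nonneg enc_int_nonpos, presburger+)
  show ?thesis
    unfolding * by (intro computable_intros assms)
qed

lemma computable_int_diff: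
  assumes "computable f" "computable g"
  shows "computable (\<lambda>x. int (f x) - int (g x))"
proof (rule computable_same_code)
  show "computable (\<lambda>x. if g x \<le> f x then 2 * (f x - g x) else 2 * (g x - f x) - 1)"
    by (intro computable_intros assms)
  show "enc (int (f x) - int (g x)) =
      enc (if g x \<le> f x then 2 * (f x - g x) else 2 * (g x - f x) - 1)" for x
  proof (cases "g x \<le> f x")
    case True
    then show ?thesis
      using enc_int_nonneg[of "f x - g x"] by (simp add: of_nat_diff enc_nat_def)
  next
    case False
    then show ?thesis
      using enc_int_nonpos[of "g x - f x"] by (simp add: of_nat_diff enc_nat_def)
  qed
qed

lemma int_parts: "i = int (nat i) - int (nat (- i))"
  by simp

lemma computable_of_nat_int [computable_intros]:
  assumes "computable f"
  shows "computable (\<lambda>x. int (f x))"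
  using computable_int_diff[OF assms computable_const[of 0]] by simp

lemma computable_add_int [computable_intros]:
  fixes f g :: "'a::enc \<Rightarrow> int"
  assumes "computable f" "computable g"
  shows "computable (\<lambda>x. f x + g x)"
proof -
  have *: "i + j = int (nat i + nat j) - int (nat (- i) + nat (- j))" for i j
    by simp
  show ?thesis
    unfolding * by (intro computable_int_diff computable_add_nat computable_nat computable_nat_minus assms)
qed

lemma computable_mult_int [computable_intros]:
  fixes f g :: "'a::enc \<Rightarrow> int"
  assumes "computable f" "computable g"
  shows "computable (\<lambda>x. f x * g x)"
proof -
  have *: "i * j = int (nat i * nat j + nat (- i) * nat (- j)) - int (nat i * nat (- j) + nat (- i) * nat j)" for i j
    by (subst int_parts[of i], subst int_parts[of j]) (simp only: of_nat_add of_nat_mult algebra_simps)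
  show ?thesis
    unfolding * by (intro computable_int_diff computable_add_nat computable_mult_nat computable_nat computable_nat_minus assms)
qed

definition num_rat :: "rat \<Rightarrow> int" where "num_rat q = fst (quotient_of q)"
definition den_rat :: "rat \<Rightarrow> nat" where "den_rat q = nat (snd (quotient_of q))"

lemma enc_rat_eq: "enc q = enc (num_rat q, den_rat q)"
  by (simp add: enc_rat_def rat_code_def enc_Pair num_rat_def den_rat_def enc_int_def enc_nat_def split: prod.split)

lemma den_rat_pos: "den_rat q > 0"
  using quotient_of_denom_pos' by (simp add: den_rat_def)

lemma rat_eq_num_den: "q = of_int (num_rat q) / of_nat (den_rat q)"
  using quotient_of_div[of q "num_rat q" "int (den_rat q)"] quotient_of_denom_pos'[of q]
  by (simp add: num_rat_def den_rat_def)

lemma coprime_num_den: "coprime (num_rat q) (int (den_rat q))"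
  using quotient_of_coprime[of q "num_rat q" "int (den_rat q)"] quotient_of_denom_pos'[of q]
  by (simp add: num_rat_def den_rat_def)

lemma computable_num_den:
  assumes "computable f"
  shows "computable (\<lambda>x. (num_rat (f x), den_rat (f x)))"
  by (rule computable_same_code[OF assms]) (simp add: enc_rat_eq)

lemma computable_num_rat [computable_intros]: "computable f \<Longrightarrow> computable (\<lambda>x. num_rat (f x))"
  using computable_fst[OF computable_num_den] by simp

lemma computable_den_rat [computable_intros]: "computable f \<Longrightarrow> computable (\<lambda>x. den_rat (f x))"
  using computable_snd[OF computable_num_den] by simp

text \<open>Division by 0 gives 0, so every pair denotes a rational. Arithmetic produces such
  unreduced pairs, and reduction is needed only to obtain the code.\<close>

definition make_rat :: "int \<Rightarrow> nat \<Rightarrow> rat" where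
  "make_rat a b = of_int a / of_nat b"

lemma make_rat_num_den: "make_rat (num_rat q) (den_rat q) = q"
  using rat_eq_num_den[of q] by (simp add: make_rat_def)

lemma num_den_make_rat:
  assumes "b \<noteq> 0"
  shows "a * int (den_rat (make_rat a b)) = num_rat (make_rat a b) * int b"
proof -
  have "of_int a / of_nat b = (of_int (num_rat (make_rat a b)) / of_nat (den_rat (make_rat a b)) :: rat)"
    using rat_eq_num_den[of "make_rat a b"] by (simp add: make_rat_def)
  then have "(of_int (a * int (den_rat (make_rat a b))) :: rat) = of_int (num_rat (make_rat a b) * int b)"
    using assms den_rat_pos[of "make_rat a b"] by (simp add: frac_eq_eq mult.commute)
  then show ?thesis by (simp only: of_int_eq_iff)
qed

text \<open>The reduced denominator is found by a search, so that no gcd has to be computed.\<close>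

lemma den_make_rat:
  "den_rat (make_rat a b) =
    (LEAST k. 0 < k \<and> (if b = 0 then True else b * ((nat a + nat (- a)) * k div b) = (nat a + nat (- a)) * k))"
proof (cases "b = 0")
  case True
  then show ?thesis
    by (auto simp: make_rat_def den_rat_def intro!: Least_equality[symmetric])
next
  case False
  let ?p = "num_rat (make_rat a b)" and ?d = "den_rat (make_rat a b)"
  \<comment> \<open>\<open>nat a + nat (- a)\<close> is the absolute value of \<open>a\<close>;
    multiplying back after \<open>div\<close> tests divisibility on natural numbers.\<close>
  have dvd: "b * ((nat a + nat (- a)) * k div b) = (nat a + nat (- a)) * k \<longleftrightarrow> int b dvd a * int k" for k
  proof -
    have "int b dvd a * int k \<longleftrightarrow> int b dvd \<bar>a * int k\<bar>" by simp
    also have "\<bar>a * int k\<bar> = int ((nat a + nat (- a)) * k)" by (simp add: abs_mult)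
    finally show ?thesis by (simp only: int_dvd_int_iff dvd_mult_div_cancel) (metis dvd_mult_div_cancel dvd_triv_left)
  qed
  have red: "a * int ?d = ?p * int b" by (rule num_den_make_rat[OF False])
  show ?thesis
  \<comment> \<open>If \<open>b\<close> divides \<open>a * k\<close>, then the reduced denominator
    divides \<open>?p * k\<close>, hence \<open>k\<close> by coprimality; it is therefore the least
    positive candidate.\<close>
  proof (rule Least_equality[symmetric])
    show "0 < ?d \<and> (if b = 0 then True else b * ((nat a + nat (- a)) * ?d div b) = (nat a + nat (- a)) * ?d)"
      using False by (simp only: dvd red den_rat_pos) simp
    fix k
    assume k: "0 < k \<and> (if b = 0 then True else b * ((nat a + nat (- a)) * k div b) = (nat a + nat (- a)) * k)"
    then have "int b dvd a * int k" using False by (simp only: dvd if_False)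
    then obtain c where "a * int k = int b * c" by (rule dvdE)
    then have "int b * (?p * int k) = int b * (int ?d * c)"
      using red by (metis mult.assoc mult.commute)
    then have "int ?d dvd ?p * int k" using False by simp
    then have "int ?d dvd int k"
      using coprime_num_den[of "make_rat a b"] by (simp add: coprime_dvd_mult_right_iff coprime_commute)
    then show "?d \<le> k" using k by (auto dest: dvd_imp_le)
  qed
qed

text \<open>Reduction preserves the fraction, so the numerator is the exact quotient of
  \<open>a\<close> times the reduced denominator by \<open>b\<close>. The division is done on
  natural numbers, once for the positive and once for the negative part of \<open>a\<close>, at
  least one of which is 0.\<close>

lemma num_make_rat:
  "num_rat (make_rat a b) =
    int (nat a * den_rat (make_rat a b) div b) - int (nat (- a) * den_rat (make_rat a b) div b)"
proof (cases "b = 0")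
  case True
  then show ?thesis by (simp add: make_rat_def num_rat_def)
next
  case False
  let ?p = "num_rat (make_rat a b)" and ?d = "den_rat (make_rat a b)"
  have red: "a * int ?d = ?p * int b" by (rule num_den_make_rat[OF False])
  show ?thesis
  proof (cases "0 \<le> a")
    case True
    have "int (nat a * ?d div b) = a * int ?d div int b"
      using True by (simp add: zdiv_int)
    then show ?thesis using True False red by simp
  next
    case neg: False
    have "int (nat (- a) * ?d div b) = (- (a * int ?d)) div int b"
      using neg by (simp add: zdiv_int)
    also have "\<dots> = (- ?p * int b) div int b" by (simp only: red) simp
    also have "\<dots> = - ?p" using False by (subst nonzero_mult_div_cancel_right) auto
    finally show ?thesis using neg by simp
  qed
qed

lemma computable_make_rat [computable_intros]:
  assumes "computable f" "computable g"
  shows "computable (\<lambda>x. make_rat (f x) (g x))"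
proof -
  have f': "computable (\<lambda>z :: 'a \<times> 'c::enc. f (fst z))" and g': "computable (\<lambda>z :: 'a \<times> 'c::enc. g (fst z))"
    by (intro computable_comp[OF assms(1)] computable_comp[OF assms(2)] computable_intros)+
  have den: "computable (\<lambda>x. den_rat (make_rat (f x) (g x)))"
    unfolding den_make_rat
  proof (intro computable_Least)
    show "computable (\<lambda>z. 0 < snd z \<and> (if g (fst z) = 0 then True else
        g (fst z) * ((nat (f (fst z)) + nat (- f (fst z))) * snd z div g (fst z)) =
        (nat (f (fst z)) + nat (- f (fst z))) * snd z))"
      by (intro computable_conj computable_If computable_less_nat computable_eq computable_const
          computable_mult_nat computable_div_nat computable_add_nat computable_nat computable_nat_minus
          computable_snd computable_id
          computable_comp[OF assms(1) computable_fst] computable_comp[OF assms(2) computable_fst])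
    show "\<exists>k. 0 < k \<and> (if g x = 0 then True else
        g x * ((nat (f x) + nat (- f x)) * k div g x) = (nat (f x) + nat (- f x)) * k)" for x
      by (rule exI[of _ "if g x = 0 then 1 else g x"]) auto
  qed
  have "computable (\<lambda>x. (num_rat (make_rat (f x) (g x)), den_rat (make_rat (f x) (g x))))"
    by (subst num_make_rat)
      (intro computable_Pair computable_int_diff computable_div_nat computable_mult_nat
        computable_nat computable_nat_minus den assms)
  then show ?thesis
    by (rule computable_same_code) (simp add: enc_rat_eq)
qed

lemma computable_add_rat [computable_intros]:
  fixes f g :: "'a::enc \<Rightarrow> rat"
  assumes "computable f" "computable g"
  shows "computable (\<lambda>x. f x + g x)"
proof -
  have *: "p + q = make_rat (num_rat p * int (den_rat q) + num_rat q * int (den_rat p)) (den_rat p * den_rat q)" for p q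
    using den_rat_pos[of p] den_rat_pos[of q]
    by (subst rat_eq_num_den[of p], subst rat_eq_num_den[of q]) (simp add: make_rat_def field_simps)
  show ?thesis
    unfolding * by (intro computable_intros assms)
qed

lemma computable_mult_rat [computable_intros]:
  fixes f g :: "'a::enc \<Rightarrow> rat"
  assumes "computable f" "computable g"
  shows "computable (\<lambda>x. f x * g x)"
proof -
  have *: "p * q = make_rat (num_rat p * num_rat q) (den_rat p * den_rat q)" for p q
    by (subst rat_eq_num_den[of p], subst rat_eq_num_den[of q]) (simp add: make_rat_def)
  show ?thesis
    unfolding * by (intro computable_intros assms)
qed

section \<open>Unbounded search for coded objects\<close>

lemma surj_enc_nat: "surj (enc :: nat \<Rightarrow> nat)"
  by (simp add: enc_nat_def surj_def)

lemma surj_enc_int: "surj (enc :: int \<Rightarrow> nat)"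
  by (simp add: enc_int_def surj_int_encode)

lemma surj_enc_prod:
  assumes "surj (enc :: 'a::enc \<Rightarrow> nat)" "surj (enc :: 'b::enc \<Rightarrow> nat)"
  shows "surj (enc :: 'a \<times> 'b \<Rightarrow> nat)"
proof (rule surjI)
  fix n
  show "enc (inv_into UNIV (enc :: 'a \<Rightarrow> nat) (fst (prod_decode n)), inv_into UNIV (enc :: 'b \<Rightarrow> nat) (snd (prod_decode n))) = n"
    by (simp add: enc_Pair surj_f_inv_f assms)
qed

lemma surj_enc_list:
  assumes "surj (enc :: 'a::enc \<Rightarrow> nat)"
  shows "surj (enc :: 'a list \<Rightarrow> nat)"
proof (rule surjI)
  fix n
  show "enc (map (inv_into UNIV (enc :: 'a \<Rightarrow> nat)) (list_decode n)) = n"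
    by (simp add: enc_list_def o_def surj_f_inv_f assms)
qed

text \<open>Minimisation runs through all numbers, but the test is known to halt only on codes.
  Surjectivity makes every number a code, so no candidate can block the search.\<close>

lemma computable_search_typed:
  fixes P :: "'a::enc \<Rightarrow> 'b::enc \<Rightarrow> bool"
  assumes "computable (\<lambda>z. P (fst z) (snd z))" and surj: "surj (enc :: 'b \<Rightarrow> nat)"
  obtains e where "\<And>x y. P x y \<Longrightarrow> \<exists>y. P x y \<and> computes e [enc x] (enc y)"
proof -
  let ?dec = "inv_into UNIV (enc :: 'b \<Rightarrow> nat)"
  have "computable (\<lambda>z. P (fst z) (?dec (snd z)))"
    by (rule computable_reinterpret[OF assms(1), where h = "\<lambda>z. (fst z, ?dec (snd z))"])
      (auto simp: enc_prod_def enc_nat_def surj_f_inv_f surj)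
  then obtain e where e: "\<And>x n. P x (?dec n) \<Longrightarrow> computes e [enc x] (LEAST n. P x (?dec n))"
    using computable_search[of "\<lambda>x n. P x (?dec n)"] by blast
  have inj: "inj (enc :: 'b \<Rightarrow> nat)"
    by (rule injI) (rule enc_inj)
  have "\<exists>y. P x y \<and> computes e [enc x] (enc y)" if "P x y" for x y
  proof -
    define n where "n = (LEAST n. P x (?dec n))"
    have *: "P x (?dec (enc y))" using that by (simp add: inv_f_f inj)
    have "P x (?dec n)" unfolding n_def by (rule LeastI[of "\<lambda>n. P x (?dec n)", OF *])
    moreover have "computes e [enc x] (enc (?dec n))"
      using e[OF *] by (simp add: n_def surj_f_inv_f surj)
    ultimately show ?thesis by blast
  qed
  with that show ?thesis by blast
qed

section \<open>Ascending chains of polynomial modules\<close>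

lemma nat_seq_incseq_subseq:
  fixes s :: "nat \<Rightarrow> nat"
  shows "\<exists>f. strict_mono f \<and> incseq (\<lambda>i. s (f i))"
proof -
  obtain f where f: "strict_mono f" "monoseq (\<lambda>i. s (f i))"
    using seq_monosub[of s] by blast
  show ?thesis
  proof (cases "incseq (\<lambda>i. s (f i))")
    case False
    \<comment> \<open>A decreasing sequence of natural numbers is constant from the index of its
      minimum on, and its tail is then increasing as well.\<close>
    then have dec: "decseq (\<lambda>i. s (f i))" using f(2) by (simp add: monoseq_iff)
    obtain N where N: "\<And>i. s (f N) \<le> s (f i)"
      using ex_has_least_nat[of "\<lambda>_. True" _ "\<lambda>i. s (f i)"] by blast
    have "s (f (N + i)) = s (f N)" for i
      using N[of "N + i"] decseqD[OF dec, of N "N + i"] by simp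
    moreover have "strict_mono (\<lambda>i. f (N + i))"
      using f(1) by (auto simp: strict_mono_def)
    ultimately show ?thesis by (intro exI[of _ "\<lambda>i. f (N + i)"]) (auto simp: incseq_def)
  qed (use f in blast)
qed

text \<open>Coordinates are treated one at a time: a further subsequence keeps the monotonicity
  already achieved.\<close>

lemma incseq_subseq_family:
  fixes x :: "nat \<Rightarrow> nat \<Rightarrow> nat"
  shows "\<exists>r. strict_mono r \<and> (\<forall>k<n. incseq (\<lambda>i. x (r i) k))"
proof (induction n)
  case 0
  then show ?case by (auto intro!: exI[of _ id] simp: strict_mono_def)
next
  case (Suc n)
  then obtain r where r: "strict_mono r" "\<And>k. k < n \<Longrightarrow> incseq (\<lambda>i. x (r i) k)" by blast
  obtain f where f: "strict_mono f" "incseq (\<lambda>i. x (r (f i)) n)"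
    using nat_seq_incseq_subseq[of "\<lambda>i. x (r i) n"] by blast
  have "incseq (\<lambda>i. x (r (f i)) k)" if "k < Suc n" for k
  proof (cases "k = n")
    case False
    with that r(2)[of k] f(1) show ?thesis
      by (auto simp: incseq_def strict_mono_less_eq)
  qed (use f in simp)
  moreover have "strict_mono (\<lambda>i. r (f i))"
    using r(1) f(1) by (auto simp: strict_mono_def)
  ultimately show ?case by blast
qed

lemma dickson:
  fixes x :: "nat \<Rightarrow> nat \<Rightarrow> nat"
  obtains i j where "i < j" "\<And>k. k < n \<Longrightarrow> x i k \<le> x j k"
proof -
  obtain r where r: "strict_mono r" "\<And>k. k < n \<Longrightarrow> incseq (\<lambda>i. x (r i) k)"
    using incseq_subseq_family by blast
  show ?thesis
  proof
    show "r 0 < r 1" using r(1) by (simp add: strict_mono_def)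
    show "x (r 0) k \<le> x (r 1) k" if "k < n" for k
      using r(2)[OF that] by (simp add: incseq_def)
  qed
qed

section \<open>Monomials in finitely many variables and Hilbert's basis theorem\<close>

abbreviation monomials :: "nat \<Rightarrow> (nat \<Rightarrow>\<^sub>0 nat) set" where
  "monomials n \<equiv> {m. Poly_Mapping.keys m \<subseteq> {..<n}}"

lemma monomial_dvdE:
  fixes m m' :: "nat \<Rightarrow>\<^sub>0 nat"
  assumes "m \<in> monomials n" "m' \<in> monomials n"
    and "\<And>k. k < n \<Longrightarrow> Poly_Mapping.lookup m k \<le> Poly_Mapping.lookup m' k"
  obtains d where "m' = d + m" "d \<in> monomials n"
proof
  have le: "Poly_Mapping.lookup m k \<le> Poly_Mapping.lookup m' k" for k
  proof (cases "k < n")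
    case False
    then have "Poly_Mapping.lookup m k = 0" using assms(1) by (auto simp: in_keys_iff subset_iff)
    then show ?thesis by simp
  qed (rule assms(3))
  show "m' = (m' - m) + m"
    by (rule poly_mapping_eqI) (simp add: lookup_add lookup_minus le)
  show "m' - m \<in> monomials n"
    using assms(2) by (auto simp: in_keys_iff lookup_minus subset_iff)
qed

lemma monomial_nonneg: "0 \<le> (m :: nat \<Rightarrow>\<^sub>0 nat)"
proof -
  have "\<not> m < 0"
    by transfer (auto simp: less_fun_def)
  then show ?thesis by simp
qed

text \<open>The order on exponents is lexicographic, the first difference deciding, and has the
  infinite descent \<open>x\<^sub>1 > x\<^sub>2 > ...\<close> when all variables are allowed. With
  \<open>n\<close> variables Dickson's lemma excludes this: some member of the chain would divide a
  later one and so could not exceed it.\<close>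

lemma wf_monomials: "wf {(m, m'). m < m' \<and> m \<in> monomials n \<and> m' \<in> monomials n}"
  unfolding wf_iff_no_infinite_down_chain
proof
  assume "\<exists>s. \<forall>i. (s (Suc i), s i) \<in> {(m, m'). m < m' \<and> m \<in> monomials n \<and> m' \<in> monomials n}"
  then obtain s where s: "\<And>i. s (Suc i) < s i" "\<And>i. s i \<in> monomials n" by blast
  obtain i j where ij: "i < j" "\<And>k. k < n \<Longrightarrow> Poly_Mapping.lookup (s i) k \<le> Poly_Mapping.lookup (s j) k"
    using dickson[of n "\<lambda>i. Poly_Mapping.lookup (s i)"] by blast
  obtain d where "s j = d + s i" using monomial_dvdE[OF s(2) s(2) ij(2)] .
  then have "s i \<le> s j" using add_right_mono[OF monomial_nonneg[of d], of "s i"] by simp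
  moreover have "s j < s i"
  proof -
    have "s (i + Suc k) < s i" for k
      by (induction k) (use s(1) in \<open>auto intro: less_trans\<close>)
    then show ?thesis using less_imp_Suc_add[OF ij(1)] by auto
  qed
  ultimately show False by simp
qed

lemma sum_single_lookup: "(\<Sum>m\<in>Poly_Mapping.keys p. Poly_Mapping.single m (Poly_Mapping.lookup p m)) = p"
  by (rule poly_mapping_eqI) (simp add: lookup_sum lookup_single when_def in_keys_iff)

lemma lookup_single_mult:
  fixes p :: "'a::comm_semiring_1 mpoly"
  shows "Poly_Mapping.lookup (Poly_Mapping.single d c * p) (d + m) = c * Poly_Mapping.lookup p m"
proof -
  have "Poly_Mapping.single d c * p =
      (\<Sum>k\<in>Poly_Mapping.keys p. Poly_Mapping.single (d + k) (c * Poly_Mapping.lookup p k))"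
    by (subst (1) sum_single_lookup[of p, symmetric]) (simp only: sum_distrib_left mult_single)
  then show ?thesis
    by (simp add: lookup_sum lookup_single when_def in_keys_iff)
qed

lemma keys_single_mult:
  fixes p :: "'a::comm_semiring_1 mpoly"
  assumes "m \<in> Poly_Mapping.keys (Poly_Mapping.single d c * p)"
  obtains k where "k \<in> Poly_Mapping.keys p" "m = d + k"
  using keys_mult[of "Poly_Mapping.single d c" p] assms by (auto split: if_splits)

text \<open>Hilbert's basis theorem for submodules of a free module of rank \<open>M\<close>: among elements of
  \<open>C (Suc i) - C i\<close> with least leading term, one leading term would divide a later one by Dickson's
  lemma, and cancelling it would give a smaller element.\<close>

theorem ascending_submodules_stabilise:
  fixes C :: "nat \<Rightarrow> (nat \<Rightarrow> 'a::field mpoly) set"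
  assumes mpolys: "\<And>i f l. f \<in> C i \<Longrightarrow> f l \<in> mpolys n"
    and support: "\<And>i f l. f \<in> C i \<Longrightarrow> M \<le> l \<Longrightarrow> f l = 0"
    and ascending: "\<And>i. C i \<subseteq> C (Suc i)"
    and zero: "\<And>i. (\<lambda>_. 0) \<in> C i"
    and closed: "\<And>i f g d c. f \<in> C i \<Longrightarrow> g \<in> C i \<Longrightarrow> d \<in> monomials n \<Longrightarrow>
      (\<lambda>l. f l + Poly_Mapping.single d c * g l) \<in> C i"
  shows "\<exists>i. C (Suc i) = C i"
proof (rule ccontr)
  assume "\<nexists>i. C (Suc i) = C i"
  then have diff: "\<exists>f. f \<in> C (Suc i) - C i" for i using ascending[of i] by blast
  \<comment> \<open>The leading term is taken position over term: the last nonzero component decides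
    first, then its largest monomial. Vectors in \<open>C (Suc i) - C i\<close> are nonzero, so
    \<open>Max\<close> is applied to nonempty sets there.\<close>
  define comp where "comp f = Max {l. f l \<noteq> 0}" for f :: "nat \<Rightarrow> 'a mpoly"
  define lm where "lm f = Max (Poly_Mapping.keys (f (comp f)))" for f :: "nat \<Rightarrow> 'a mpoly"
  define less where "less = less_than <*lex*> {(m, m'). m < m' \<and> m \<in> monomials n \<and> m' \<in> monomials n}"
  have wf: "wf (inv_image less (\<lambda>f. (comp f, lm f)))"
    unfolding less_def by (intro wf_inv_image wf_lex_prod wf_less_than wf_monomials)
  have "\<exists>f \<in> C (Suc i) - C i. \<forall>g. ((comp g, lm g), (comp f, lm f)) \<in> less \<longrightarrow> g \<notin> C (Suc i) - C i" for i
    using diff[of i] wfE_min[OF wf] unfolding in_inv_image by (metis (no_types, lifting))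
  then obtain f where f: "\<And>i. f i \<in> C (Suc i) - C i"
    and min: "\<And>i g. ((comp g, lm g), (comp (f i), lm (f i))) \<in> less \<Longrightarrow> g \<notin> C (Suc i) - C i"
    by metis
  have lead: "finite {l. g l \<noteq> 0}" "comp g < M" "g (comp g) \<noteq> 0" "lm g \<in> Poly_Mapping.keys (g (comp g))" "lm g \<in> monomials n"
    if "g \<in> C (Suc i) - C i" for g i
  proof -
    have sub: "{l. g l \<noteq> 0} \<subseteq> {..<M}" using support[of g "Suc i"] that by (auto simp: not_le[symmetric])
    then show fin: "finite {l. g l \<noteq> 0}" by (rule finite_subset) simp
    have "g \<noteq> (\<lambda>_. 0)" using zero[of i] that by auto
    then have "{l. g l \<noteq> 0} \<noteq> {}" by auto
    with fin have "comp g \<in> {l. g l \<noteq> 0}" unfolding comp_def by (rule Max_in)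
    then show nz: "g (comp g) \<noteq> 0" and "comp g < M" using sub by auto
    from nz show "lm g \<in> Poly_Mapping.keys (g (comp g))"
      unfolding lm_def by (intro Max_in) auto
    then show "lm g \<in> monomials n" using mpolys[of g "Suc i"] that by (auto simp: mpolys_def)
  qed
  \<comment> \<open>The component and its complement in \<open>M\<close> are two extra coordinates.
    Both can be monotone only if the two components agree, so Dickson's lemma also puts the leading
    terms in the same position.\<close>
  define x where "x i k = (if k < n then Poly_Mapping.lookup (lm (f i)) k
    else if k = n then comp (f i) else M - comp (f i))" for i k
  obtain i j where ij: "i < j" and le: "\<And>k. k < n + 2 \<Longrightarrow> x i k \<le> x j k"
    using dickson[of "n + 2" x] by blast
  have comp_eq: "comp (f i) = comp (f j)"
    using le[of n] le[of "Suc n"] lead(2)[OF f, of i] lead(2)[OF f, of j] by (simp add: x_def)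
  have "Poly_Mapping.lookup (lm (f i)) k \<le> Poly_Mapping.lookup (lm (f j)) k" if "k < n" for k
    using le[of k] that by (simp add: x_def)
  then obtain d where d: "lm (f j) = d + lm (f i)" "d \<in> monomials n"
    using monomial_dvdE[OF lead(5)[OF f] lead(5)[OF f], of i j] by blast
  define l where "l = comp (f j)"
  define c where "c = - Poly_Mapping.lookup (f j l) (lm (f j)) / Poly_Mapping.lookup (f i l) (lm (f i))"
  define g where "g = (\<lambda>l. f j l + Poly_Mapping.single d c * f i l)"
  \<comment> \<open>Since \<open>f i\<close> already lies in \<open>C j\<close>, adding a multiple
    of it to \<open>f j\<close> neither leaves \<open>C (Suc j)\<close> nor enters
    \<open>C j\<close>; the result competes with \<open>f j\<close> for minimality.\<close>
  have "C (Suc i) \<subseteq> C j"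
    using ij by (intro lift_Suc_mono_le[of C, OF ascending]) simp
  then have fi: "f i \<in> C j" using f[of i] by auto
  then have "g \<in> C (Suc j)"
    unfolding g_def using f[of j] ascending[of j] d(2) by (intro closed) auto
  moreover have "g \<notin> C j"
  proof
    assume "g \<in> C j"
    then have "(\<lambda>l. g l + Poly_Mapping.single d (- c) * f i l) \<in> C j" by (intro closed fi d(2))
    also have "(\<lambda>l. g l + Poly_Mapping.single d (- c) * f i l) = f j"
      by (simp add: g_def single_uminus)
    finally show False using f[of j] by simp
  qed
  ultimately have g: "g \<in> C (Suc j) - C j" by simp
  have above: "f i l' = 0" "f j l' = 0" if "l < l'" for l'
    using Max_ge[OF lead(1)[OF f], of l' i] Max_ge[OF lead(1)[OF f], of l' j] that comp_eq
    unfolding l_def comp_def by (metis (mono_tags, lifting) mem_Collect_eq not_le)+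
  then have "g l' = 0" if "l < l'" for l' using that by (simp add: g_def)
  then have comp_le: "comp g \<le> l" using lead(3)[OF g] by (meson not_le)
  have "((comp g, lm g), (comp (f j), lm (f j))) \<in> less"
  proof (cases "comp g = l")
    case True
    have max: "m \<le> lm h" if "comp h = l" "m \<in> Poly_Mapping.keys (h l)" for m h
      using that unfolding lm_def by simp
    have "lm g \<in> Poly_Mapping.keys (g l)" using lead(4)[OF g] True by simp
    moreover have "Poly_Mapping.lookup (g l) (lm (f j)) = 0"
    proof -
      have "Poly_Mapping.lookup (f i l) (lm (f i)) \<noteq> 0"
        using lead(4)[OF f, of i] by (simp add: comp_eq l_def in_keys_iff)
      then show ?thesis
        unfolding g_def lookup_add by (subst (2) d(1)) (simp add: lookup_single_mult c_def)
    qed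
    ultimately have "lm g \<noteq> lm (f j)" by (auto simp: in_keys_iff)
    moreover have "lm g \<le> lm (f j)"
    proof -
      have "lm g \<in> Poly_Mapping.keys (f j l) \<or> lm g \<in> Poly_Mapping.keys (Poly_Mapping.single d c * f i l)"
        using \<open>lm g \<in> Poly_Mapping.keys (g l)\<close> keys_add[of "f j l"] by (auto simp: g_def)
      then show ?thesis
      proof
        assume "lm g \<in> Poly_Mapping.keys (Poly_Mapping.single d c * f i l)"
        then obtain k where "k \<in> Poly_Mapping.keys (f i l)" "lm g = d + k" by (rule keys_single_mult)
        then show ?thesis using max[of "f i" k] comp_eq d(1) l_def by (simp add: add_left_mono)
      qed (simp add: max l_def)
    qed
    ultimately show ?thesis
      using True lead(5)[OF g] lead(5)[OF f, of j] by (simp add: less_def l_def)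
  qed (use comp_le in \<open>simp add: less_def l_def\<close>)
  with min g show False by blast
qed

section \<open>Polynomials as lists of terms\<close>

type_synonym terms = "(rat \<times> nat list) list"

definition mono_mul :: "rat \<times> nat list \<Rightarrow> rat \<times> nat list \<Rightarrow> rat \<times> nat list" where
  "mono_mul s t = (fst s * fst t, map (\<lambda>z. fst z + snd z) (zip (snd s) (snd t)))"

definition pmul :: "terms \<Rightarrow> terms \<Rightarrow> terms" where
  "pmul p q = concat (map (\<lambda>s. map (mono_mul s) q) p)"

text \<open>Each term starts as a constant and is multiplied by the powers of the coordinates of
  \<open>F\<close>. The zero exponent vector copies the length of the old one, which keeps the
  number of variables.\<close>

definition psubst :: "terms list \<Rightarrow> terms \<Rightarrow> terms" where
  "psubst F p = concat (map (\<lambda>t.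
     fold (\<lambda>z r. (pmul (fst z) ^^ snd z) r) (zip F (snd t)) [(fst t, map (\<lambda>_. 0) (snd t))]) p)"

definition pprod :: "nat \<Rightarrow> terms list \<Rightarrow> terms" where
  "pprod n hs = fold pmul hs [(1, replicate n 0)]"

definition is_zero :: "terms \<Rightarrow> bool" where
  "is_zero p = list_all (\<lambda>t. fold (\<lambda>s c. if snd s = snd t then fst s + c else c) p 0 = 0) p"

text \<open>Words grow at the front, not at the back: prepending a letter acts on all rows by the
  same substitution and the same factor \<open>h\<close>, so no products over prefixes have to be
  stored. The empty word is put back by \<open>gs\<close>.\<close>

definition next_rows :: "terms \<Rightarrow> terms list list \<Rightarrow> terms list \<Rightarrow> terms list list \<Rightarrow> terms list list" where
  "next_rows h Fs gs R =
     gs # concat (map (\<lambda>F. map (map (\<lambda>p. pmul h (psubst F p))) R) Fs)"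

definition rows_upto :: "terms \<Rightarrow> terms list list \<Rightarrow> terms list \<Rightarrow> nat \<Rightarrow> terms list list" where
  "rows_upto h Fs gs N = (next_rows h Fs gs ^^ N) [gs]"

text \<open>Starting from \<open>r\<close> turns membership in the module of the rows into a test
  for zero; the cofactors are then those of \<open>- r\<close>.\<close>

definition add_combination :: "terms list \<Rightarrow> terms list list \<Rightarrow> terms list \<Rightarrow> terms list" where
  "add_combination qs R r =
     fold (\<lambda>z r. map (\<lambda>w. fst w @ snd w) (zip (map (pmul (fst z)) (snd z)) r)) (zip qs R) r"

definition wf_terms :: "nat \<Rightarrow> terms \<Rightarrow> bool" where
  "wf_terms n p = list_all (\<lambda>t. length (snd t) = n) p"

text \<open>The search meets arbitrary candidates, so the lengths of exponent vectors are checked: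
  without that the truncating \<open>zip\<close> in products would falsify the arithmetic. A short
  list of cofactors is harmless, as the missing ones count as zero.\<close>

definition is_syzygy :: "nat \<Rightarrow> terms list list \<Rightarrow> terms list \<Rightarrow> terms list \<Rightarrow> bool" where
  "is_syzygy n R r qs \<longleftrightarrow> list_all (wf_terms n) qs \<and> list_all is_zero (add_combination qs R r)"

type_synonym cofactor = "((int \<times> nat) \<times> nat list) list"

definition terms_of :: "cofactor \<Rightarrow> terms" where
  "terms_of q = map (\<lambda>t. (make_rat (fst (fst t)) (snd (fst t)), snd t)) q"

type_synonym input = "nat \<times> terms list \<times> terms list \<times> terms list list"

definition input_rows :: "input \<Rightarrow> nat \<Rightarrow> terms list list" where
  "input_rows x N = rows_upto (pprod (fst x) (fst (snd (snd x)))) (snd (snd (snd x))) (fst (snd x)) N"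

definition certifies :: "input \<Rightarrow> nat \<times> cofactor list list \<Rightarrow> bool" where
  "certifies x y \<longleftrightarrow> list_all (\<lambda>r. list_ex (\<lambda>qs. is_syzygy (fst x) (input_rows x (fst y)) r (map terms_of qs)) (snd y))
     (input_rows x (Suc (fst y)))"

lemma computable_pmul [computable_intros]:
  assumes "computable p" "computable q"
  shows "computable (\<lambda>x. pmul (p x) (q x))"
  by (rule computable_comp2[where F = pmul, OF _ assms]) (unfold pmul_def mono_mul_def, intro computable_intros)

lemma computable_psubst [computable_intros]:
  assumes "computable p" "computable q"
  shows "computable (\<lambda>x. psubst (p x) (q x))"
  by (rule computable_comp2[where F = psubst, OF _ assms]) (unfold psubst_def, intro computable_intros)

lemma computable_pprod [computable_intros]:
  assumes "computable p" "computable q"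
  shows "computable (\<lambda>x. pprod (p x) (q x))"
  by (rule computable_comp2[where F = pprod, OF _ assms]) (unfold pprod_def, intro computable_intros)

lemma computable_is_zero [computable_intros]:
  assumes "computable p"
  shows "computable (\<lambda>x. is_zero (p x))"
  by (rule computable_comp[OF _ assms]) (unfold is_zero_def, intro computable_intros)

lemma computable_wf_terms [computable_intros]:
  assumes "computable p" "computable q"
  shows "computable (\<lambda>x. wf_terms (p x) (q x))"
  by (rule computable_comp2[where F = wf_terms, OF _ assms]) (unfold wf_terms_def, intro computable_intros)

lemma computable_terms_of [computable_intros]:
  assumes "computable p"
  shows "computable (\<lambda>x. terms_of (p x))"
  by (rule computable_comp[OF _ assms]) (unfold terms_of_def, intro computable_intros)

lemma computable_add_combination [computable_intros]:
  assumes "computable p" "computable q" "computable r"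
  shows "computable (\<lambda>x. add_combination (p x) (q x) (r x))"
  by (rule computable_comp3[where F = add_combination, OF _ assms]) (unfold add_combination_def, intro computable_intros)

lemma computable_input_rows [computable_intros]:
  assumes "computable p" "computable q"
  shows "computable (\<lambda>x. input_rows (p x) (q x))"
  by (rule computable_comp2[where F = input_rows, OF _ assms])
    (unfold input_rows_def rows_upto_def next_rows_def, intro computable_intros)

lemma computable_certifies: "computable (\<lambda>z. certifies (fst z) (snd z))"
  unfolding certifies_def is_syzygy_def by (intro computable_intros)

lemma surj_enc_certificate: "surj (enc :: nat \<times> cofactor list list \<Rightarrow> nat)"
  by (intro surj_enc_prod surj_enc_list surj_enc_nat surj_enc_int)

lemma certificate_search:
  obtains e where "\<And>x y. certifies x y \<Longrightarrow> \<exists>y. certifies x y \<and> computes e [enc x] (enc y)"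
  using computable_search_typed[OF computable_certifies surj_enc_certificate] by blast

text \<open>The input code is a list whose entries are codes of different types. Read as a list of
  numbers it is unpacked into a quadruple, and the quadruple of codes has the same code as the typed
  input.\<close>

lemma algorithm_exists:
  "\<exists>alg. \<forall>n gs hs Fs y. certifies (n, gs, hs, Fs) y \<longrightarrow> (\<exists>N ys. certifies (n, gs, hs, Fs) (N, ys) \<and>
     computes alg [list_encode [n, enc gs, enc hs, enc Fs]]
       (list_encode [length (input_rows (n, gs, hs, Fs) N), length gs, enc (input_rows (n, gs, hs, Fs) N)]))"
proof -
  obtain es where es: "\<And>x y. certifies x y \<Longrightarrow> \<exists>y. certifies x y \<and> computes es [enc x] (enc y)"
    using certificate_search by blast
  \<comment> \<open>The zeros only make the function total; lists with four entries never reach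
    them.\<close>
  have "computable (\<lambda>l :: nat list. case l of [] \<Rightarrow> (0, 0, 0, 0) | a # l \<Rightarrow> (case l of [] \<Rightarrow> (0, 0, 0, 0) | b # l \<Rightarrow>
      (case l of [] \<Rightarrow> (0, 0, 0, 0) | c # l \<Rightarrow> (case l of [] \<Rightarrow> (0, 0, 0, 0) | d # l \<Rightarrow> (a, b, c, d :: nat)))))"
    by (intro computable_intros)
  then obtain ei where ei: "\<And>l. computes ei [enc l] (enc (case l of [] \<Rightarrow> (0, 0, 0, 0) | a # l \<Rightarrow> (case l of [] \<Rightarrow> (0, 0, 0, 0) | b # l \<Rightarrow>
      (case l of [] \<Rightarrow> (0, 0, 0, 0) | c # l \<Rightarrow> (case l of [] \<Rightarrow> (0, 0, 0, 0) | d # l \<Rightarrow> (a, b, c, d :: nat))))))"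
    unfolding computable_def by blast
  have "computable (\<lambda>z :: input \<times> nat \<times> cofactor list list. [length (input_rows (fst z) (fst (snd z))), length (fst (snd (fst z))),
      enc (input_rows (fst z) (fst (snd z)))])"
    by (intro computable_intros)
  then obtain eo where eo: "\<And>z :: input \<times> nat \<times> cofactor list list. computes eo [enc z] (enc [length (input_rows (fst z) (fst (snd z))), length (fst (snd (fst z))),
      enc (input_rows (fst z) (fst (snd z)))])"
    unfolding computable_def by blast
  have enc_nats: "enc l = list_encode l" for l :: "nat list"
    by (simp add: enc_list_def enc_nat_def[abs_def])
  define alg where "alg = Comp eo [Comp pair_recf [ei, Comp es [ei]]]"
  have "\<exists>N ys. certifies x (N, ys) \<and>
     computes alg [list_encode [n, enc gs, enc hs, enc Fs]]
       (list_encode [length (input_rows x N), length gs, enc (input_rows x N)])"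
    if cert: "certifies x y" and x: "x = (n, gs, hs, Fs)" for n gs hs Fs x y
  proof -
    obtain N ys where y: "certifies x (N, ys)" "computes es [enc x] (enc (N, ys))"
      using es[OF cert] by auto
    have i: "computes ei [list_encode [n, enc gs, enc hs, enc Fs]] (enc x)"
      using ei[of "[n, enc gs, enc hs, enc Fs]"] by (simp add: enc_nats x enc_Pair enc_nat_def)
    have "computes (Comp es [ei]) [list_encode [n, enc gs, enc hs, enc Fs]] (enc (N, ys))"
      by (rule computes_Comp1[OF i y(2)])
    then have "computes (Comp pair_recf [ei, Comp es [ei]]) [list_encode [n, enc gs, enc hs, enc Fs]] (enc (x, N, ys))"
      unfolding enc_Pair[of x] by (rule computes_Comp2[OF i _ computes_pair_recf])
    then have "computes alg [list_encode [n, enc gs, enc hs, enc Fs]]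
        (enc [length (input_rows x N), length gs, enc (input_rows x N)])"
      unfolding alg_def using eo[of "(x, N, ys)"] by (auto simp: x intro: computes_Comp1)
    with y(1) show ?thesis unfolding enc_nats by blast
  qed
  then show ?thesis by blast
qed

section \<open>Semantics of term lists\<close>

lemma wf_terms_Nil [simp]: "wf_terms n []"
  and wf_terms_Cons [simp]: "wf_terms n (t # p) \<longleftrightarrow> length (snd t) = n \<and> wf_terms n p"
  and wf_terms_append [simp]: "wf_terms n (p @ q) \<longleftrightarrow> wf_terms n p \<and> wf_terms n q"
  by (auto simp: wf_terms_def)

lemma pmul_Nil [simp]: "pmul [] q = []"
  and pmul_Cons [simp]: "pmul (s # p) q = map (mono_mul s) q @ pmul p q"
  by (simp_all add: pmul_def)

lemma wf_terms_map_mono_mul: "length (snd s) = n \<Longrightarrow> wf_terms n q \<Longrightarrow> wf_terms n (map (mono_mul s) q)"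
  by (induction q) (auto simp: mono_mul_def)

lemma wf_terms_pmul: "wf_terms n p \<Longrightarrow> wf_terms n q \<Longrightarrow> wf_terms n (pmul p q)"
  by (induction p) (auto simp: wf_terms_map_mono_mul)

lemma wf_terms_funpow: "wf_terms n p \<Longrightarrow> wf_terms n q \<Longrightarrow> wf_terms n ((pmul p ^^ k) q)"
  by (induction k) (auto simp: wf_terms_pmul)

text \<open>Two semantics share this sum: the polynomial denoted by a list and its value at a
  complex point. Facts about products and combinations of rows are proved once for both.\<close>

definition term_sum :: "(rat \<times> nat list \<Rightarrow> 'r) \<Rightarrow> terms \<Rightarrow> 'r::comm_ring_1" where
  "term_sum \<psi> p = (\<Sum>t\<leftarrow>p. \<psi> t)"

lemma term_sum_Nil [simp]: "term_sum \<psi> [] = 0"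
  and term_sum_Cons [simp]: "term_sum \<psi> (t # p) = \<psi> t + term_sum \<psi> p"
  and term_sum_append [simp]: "term_sum \<psi> (p @ q) = term_sum \<psi> p + term_sum \<psi> q"
  by (simp_all add: term_sum_def)

text \<open>The restriction to equal lengths reflects that \<open>zip\<close> truncates;
  \<open>wf_terms\<close> provides it.\<close>

definition multiplicative :: "(rat \<times> nat list \<Rightarrow> 'r::comm_ring_1) \<Rightarrow> bool" where
  "multiplicative \<psi> \<longleftrightarrow> (\<forall>s t. length (snd s) = length (snd t) \<longrightarrow> \<psi> (mono_mul s t) = \<psi> s * \<psi> t)"

lemma term_sum_pmul:
  assumes "multiplicative \<psi>" "wf_terms n p" "wf_terms n q"
  shows "term_sum \<psi> (pmul p q) = term_sum \<psi> p * term_sum \<psi> q"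
  using assms(2)
proof (induction p)
  case (Cons s p)
  have "term_sum \<psi> (map (mono_mul s) q) = \<psi> s * term_sum \<psi> q"
  proof -
    have "\<psi> (mono_mul s t) = \<psi> s * \<psi> t" if "length (snd t) = n" for t
      using assms(1) Cons.prems that by (simp add: multiplicative_def del: split_paired_All)
    then show ?thesis
      using assms(3) by (induction q) (simp_all add: distrib_left)
  qed
  with Cons show ?case by (simp add: algebra_simps)
qed simp

lemma term_sum_funpow:
  assumes "multiplicative \<psi>" "wf_terms n p" "wf_terms n q"
  shows "term_sum \<psi> ((pmul p ^^ k) q) = term_sum \<psi> p ^ k * term_sum \<psi> q"
  by (induction k) (simp_all add: term_sum_pmul[OF assms(1,2)] wf_terms_funpow assms mult.assoc)

lemma length_add_combination:
  assumes "\<forall>row \<in> set R. length row = m" "length r = m"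
  shows "length (add_combination qs R r) = m"
proof -
  have "length (fold (\<lambda>z r. map (\<lambda>w. fst w @ snd w) (zip (map (pmul (fst z)) (snd z)) r)) zs r) = m"
    if "\<forall>z \<in> set zs. length (snd z) = m" for zs
    using that assms(2) by (induction zs arbitrary: r) auto
  moreover have "\<forall>z \<in> set (zip qs R). length (snd z) = m"
    using assms(1) by (auto dest: set_zip_rightD)
  ultimately show ?thesis
    unfolding add_combination_def by blast
qed

lemma add_combination_nth:
  assumes "\<forall>row \<in> set R. length row = m \<and> list_all (wf_terms n) row" "list_all (wf_terms n) qs"
    and "length r = m" "list_all (wf_terms n) r" "l < m" and mult: "multiplicative \<psi>"
  shows "wf_terms n (add_combination qs R r ! l)"
    and "term_sum \<psi> (add_combination qs R r ! l) =
      term_sum \<psi> (r ! l) + (\<Sum>z\<leftarrow>zip qs R. term_sum \<psi> (fst z) * term_sum \<psi> (snd z ! l))"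
proof -
  let ?step = "\<lambda>z r. map (\<lambda>w. fst w @ snd w) (zip (map (pmul (fst z)) (snd z)) r)"
  have "wf_terms n (fold ?step zs r ! l) \<and> term_sum \<psi> (fold ?step zs r ! l) =
      term_sum \<psi> (r ! l) + (\<Sum>z\<leftarrow>zs. term_sum \<psi> (fst z) * term_sum \<psi> (snd z ! l))"
    if "\<forall>z \<in> set zs. wf_terms n (fst z) \<and> length (snd z) = m \<and> list_all (wf_terms n) (snd z)" for zs
    using that assms(3,4)
  proof (induction zs arbitrary: r)
    case Nil
    then show ?case using assms(5) by (simp add: list_all_length)
  next
    case (Cons z zs)
    have z: "wf_terms n (fst z)" "length (snd z) = m" "\<And>l. l < m \<Longrightarrow> wf_terms n (snd z ! l)"
      using Cons.prems by (auto simp: list_all_length)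
    have r: "length (?step z r) = m" "list_all (wf_terms n) (?step z r)"
      using Cons.prems z by (auto simp: list_all_length wf_terms_pmul)
    have "term_sum \<psi> (?step z r ! l) = term_sum \<psi> (fst z) * term_sum \<psi> (snd z ! l) + term_sum \<psi> (r ! l)"
      using Cons.prems z assms(5) by (simp add: term_sum_pmul[OF mult z(1)])
    with Cons.IH[OF _ r] Cons.prems(1) show ?case by (simp add: algebra_simps)
  qed
  moreover have "\<forall>z \<in> set (zip qs R). wf_terms n (fst z) \<and> length (snd z) = m \<and> list_all (wf_terms n) (snd z)"
    using assms(1,2) by (auto simp: list_all_iff dest: set_zip_leftD set_zip_rightD)
  ultimately show "wf_terms n (add_combination qs R r ! l)"
    and "term_sum \<psi> (add_combination qs R r ! l) =
      term_sum \<psi> (r ! l) + (\<Sum>z\<leftarrow>zip qs R. term_sum \<psi> (fst z) * term_sum \<psi> (snd z ! l))"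
    unfolding add_combination_def by auto
qed

definition sem :: "terms \<Rightarrow> rat mpoly" where
  "sem = term_sum (\<lambda>t. Poly_Mapping.single (Poly_Mapping.nth (snd t)) (fst t))"

lemma nth_mono_mul:
  assumes "length e = length e'"
  shows "Poly_Mapping.nth (map (\<lambda>z. fst z + snd z) (zip e e')) = Poly_Mapping.nth e + Poly_Mapping.nth e'"
  using assms by (intro poly_mapping_eqI) (auto simp: lookup_add nth_default_def)

lemma multiplicative_sem: "multiplicative (\<lambda>t. Poly_Mapping.single (Poly_Mapping.nth (snd t)) (fst t))"
  by (auto simp: multiplicative_def mult_single mono_mul_def nth_mono_mul)

lemma mpoly_code_iff: "mpoly_code n p c \<longleftrightarrow> (\<exists>ts. c = enc ts \<and> wf_terms n ts \<and> p = sem ts)"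
proof -
  have "map enc = (\<lambda>e :: nat list. e)"
    by (simp add: enc_nat_def[abs_def] fun_eq_iff)
  then have "term_code = enc"
    by (simp add: term_code_def enc_prod_def enc_rat_def enc_list_def fun_eq_iff)
  then show ?thesis
    by (auto simp: mpoly_code_def enc_list_def wf_terms_def list_all_iff sem_def term_sum_def)
qed

lemma keys_nth_subset: "Poly_Mapping.keys (Poly_Mapping.nth e) \<subseteq> {..<length e}"
  by (rule subsetI) (simp add: in_keys_iff nth_default_def split: if_splits del: keys_nth)

lemma sem_mpolys: "wf_terms n p \<Longrightarrow> sem p \<in> mpolys n"
proof (induction p)
  case (Cons t p)
  have "Poly_Mapping.keys (Poly_Mapping.nth (snd t)) \<subseteq> {..<n}"
    using Cons.prems keys_nth_subset[of "snd t"] by simp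
  with Cons show ?case
    using keys_add[of "Poly_Mapping.single (Poly_Mapping.nth (snd t)) (fst t)" "sem p"]
    by (fastforce simp: mpolys_def sem_def split: if_splits)
qed (simp add: sem_def mpolys_def)

lemma nth_inject: "length e = length e' \<Longrightarrow> Poly_Mapping.nth e = Poly_Mapping.nth e' \<longleftrightarrow> e = e'"
  by (auto simp: poly_mapping_eq_iff fun_eq_iff nth_default_def intro!: nth_equalityI split: if_splits)

text \<open>Every monomial of \<open>sem p\<close> stems from a listed term, so it suffices to
  inspect the listed exponents. Equal length is essential: vectors that differ only by trailing
  zeros denote the same monomial but compare as different.\<close>

lemma is_zero_iff:
  assumes "wf_terms n p"
  shows "is_zero p \<longleftrightarrow> sem p = 0"
proof -
  have coeff: "fold (\<lambda>s c. if snd s = e then fst s + c else c) p c0 = Poly_Mapping.lookup (sem p) (Poly_Mapping.nth e) + c0"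
    if "length e = n" for e c0
    using assms
  proof (induction p arbitrary: c0)
    case (Cons s p)
    then show ?case
      using that nth_inject[of "snd s" e] by (auto simp: sem_def lookup_add lookup_single when_def)
  qed (simp add: sem_def)
  have "\<exists>t \<in> set p. k = Poly_Mapping.nth (snd t)" if "Poly_Mapping.lookup (sem p) k \<noteq> 0" for k
    using that by (induction p) (auto simp: sem_def lookup_add lookup_single when_def split: if_splits)
  then have "sem p = 0 \<longleftrightarrow> (\<forall>t \<in> set p. Poly_Mapping.lookup (sem p) (Poly_Mapping.nth (snd t)) = 0)"
    by (metis lookup_zero poly_mapping_eqI)
  with assms show ?thesis
    by (auto simp: is_zero_def list_all_iff coeff wf_terms_def)
qed

text \<open>The codes of rationals are not surjective; searching over unreduced fractions avoids this.\<close>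

lemma cofactor_exists:
  assumes "p \<in> mpolys n"
  obtains q where "wf_terms n (terms_of q)" "sem (terms_of q) = p"
proof -
  obtain ts where ts: "wf_terms n ts" "p = sem ts"
    using mpoly_code_exists[OF assms] by (auto simp: mpoly_code_iff)
  have "terms_of (map (\<lambda>t. ((num_rat (fst t), den_rat (fst t)), snd t)) ts) = ts"
    by (simp add: terms_of_def o_def make_rat_num_den)
  with ts that show ?thesis by metis
qed

section \<open>Evaluation at complex points\<close>

definition monomial_eval :: "complex vec \<Rightarrow> nat list \<Rightarrow> complex" where
  "monomial_eval a e = (\<Prod>i<length e. (a $ i) ^ (e ! i))"

definition terms_eval :: "complex vec \<Rightarrow> terms \<Rightarrow> complex" where
  "terms_eval a = term_sum (\<lambda>t. of_rat (fst t) * monomial_eval a (snd t))"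

lemma multiplicative_eval: "multiplicative (\<lambda>t. of_rat (fst t) * monomial_eval a (snd t))"
  by (auto simp: multiplicative_def monomial_eval_def mono_mul_def of_rat_mult power_add prod.distrib)

text \<open>Monomials can cancel in a sum; summing over a common superset of the supports avoids
  tracking which ones survive.\<close>

lemma mpoly_eval_superset:
  assumes "finite K" "Poly_Mapping.keys p \<subseteq> K"
  shows "mpoly_eval p a = (\<Sum>m\<in>K. Poly_Mapping.lookup p m *
     (\<Prod>i \<in> Poly_Mapping.keys m. (a $ i) ^ Poly_Mapping.lookup m i))"
  unfolding mpoly_eval_def using assms by (intro sum.mono_neutral_left) (auto simp: in_keys_iff)

lemma mpoly_eval_add: "mpoly_eval (p + q) a = mpoly_eval p a + mpoly_eval q a"
proof -
  let ?K = "Poly_Mapping.keys p \<union> Poly_Mapping.keys q"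
  have "finite ?K" "Poly_Mapping.keys (p + q) \<subseteq> ?K"
    using keys_add[of p q] by auto
  then show ?thesis
    by (simp add: mpoly_eval_superset[of ?K] lookup_add distrib_right sum.distrib)
qed

lemma mpoly_eval_scale: "mpoly_eval (mpoly_scale c p) a = c * mpoly_eval p a"
proof -
  have "Poly_Mapping.keys (mpoly_scale c p) \<subseteq> Poly_Mapping.keys p"
    by (auto simp: mpoly_scale_def in_keys_iff map.rep_eq when_def split: if_splits)
  then have "mpoly_eval (mpoly_scale c p) a = (\<Sum>m\<in>Poly_Mapping.keys p. Poly_Mapping.lookup (mpoly_scale c p) m *
     (\<Prod>i \<in> Poly_Mapping.keys m. (a $ i) ^ Poly_Mapping.lookup m i))"
    by (intro mpoly_eval_superset) auto
  also have "\<dots> = c * mpoly_eval p a"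
    by (auto simp: mpoly_eval_def mpoly_scale_def map.rep_eq when_def sum_distrib_left mult.assoc intro!: sum.cong)
  finally show ?thesis .
qed

lemma mpoly_eval_zero [simp]: "mpoly_eval 0 a = 0"
  by (simp add: mpoly_eval_def)

lemma mpoly_eval_sum: "finite I \<Longrightarrow> mpoly_eval (\<Sum>i\<in>I. p i) a = (\<Sum>i\<in>I. mpoly_eval (p i) a)"
  by (induction I rule: finite_induct) (simp_all add: mpoly_eval_add)

lemma cpoly_add: "cpoly (p + q) = cpoly p + cpoly q"
  unfolding cpoly_def
  by (rule poly_mapping_eqI) (auto simp: map.rep_eq lookup_add when_def of_rat_add simp flip: of_rat_add)

lemma mpoly_eval_cpoly_sem: "mpoly_eval (cpoly (sem p)) a = terms_eval a p"
proof (induction p)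
  case Nil
  have "cpoly 0 = 0"
    unfolding cpoly_def by (rule poly_mapping_eqI) (simp add: map.rep_eq)
  then show ?case by (simp add: sem_def terms_eval_def)
next
  case (Cons t p)
  have "mpoly_eval (cpoly (Poly_Mapping.single (Poly_Mapping.nth (snd t)) (fst t))) a
      = of_rat (fst t) * monomial_eval a (snd t)"
  proof -
    let ?k = "Poly_Mapping.nth (snd t)"
    have "(\<Prod>i \<in> Poly_Mapping.keys ?k. (a $ i) ^ Poly_Mapping.lookup ?k i) = monomial_eval a (snd t)"
      unfolding monomial_eval_def
      by (intro prod.mono_neutral_cong_left)
        (use keys_nth_subset[of "snd t"] in \<open>auto simp: in_keys_iff nth_default_def simp del: keys_nth\<close>)
    then show ?thesis
      by (simp add: cpoly_def mpoly_eval_def)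
  qed
  with Cons show ?case
    by (simp add: sem_def terms_eval_def cpoly_add mpoly_eval_add)
qed

lemma psubst_Nil [simp]: "psubst F [] = []"
  and psubst_Cons [simp]: "psubst F (t # p) =
     fold (\<lambda>z r. (pmul (fst z) ^^ snd z) r) (zip F (snd t)) [(fst t, map (\<lambda>_. 0) (snd t))] @ psubst F p"
  by (simp_all add: psubst_def)

text \<open>Substitution is specified only through its values at complex points. The link with the
  loop asks for no more, and syzygies treat the substituted rows as given polynomials.\<close>

lemma
  assumes "wf_terms n p" "list_all (wf_terms n) F" "length F = n"
  shows wf_terms_psubst: "wf_terms n (psubst F p)"
    and terms_eval_psubst: "terms_eval a (psubst F p) = terms_eval (vec n (\<lambda>j. terms_eval a (F ! j))) p"
proof -
  let ?b = "vec n (\<lambda>j. terms_eval a (F ! j))"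
  have fold: "wf_terms n (fold (\<lambda>z r. (pmul (fst z) ^^ snd z) r) zs r) \<and>
      terms_eval a (fold (\<lambda>z r. (pmul (fst z) ^^ snd z) r) zs r) =
      (\<Prod>z\<leftarrow>zs. terms_eval a (fst z) ^ snd z) * terms_eval a r"
    if "\<forall>z\<in>set zs. wf_terms n (fst z)" "wf_terms n r" for zs r
    using that
    by (induction zs arbitrary: r)
      (simp_all add: wf_terms_funpow term_sum_funpow[OF multiplicative_eval, where n = n] terms_eval_def)
  have mon: "wf_terms n (fold (\<lambda>z r. (pmul (fst z) ^^ snd z) r) (zip F e) [(c, map (\<lambda>_. 0) e)]) \<and>
      terms_eval a (fold (\<lambda>z r. (pmul (fst z) ^^ snd z) r) (zip F e) [(c, map (\<lambda>_. 0) e)]) =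
      of_rat c * monomial_eval ?b e" if e: "length e = n" for c e
  proof -
    have "\<forall>z\<in>set (zip F e). wf_terms n (fst z)"
      using assms(2) by (auto simp: list_all_iff dest: set_zip_leftD)
    moreover have "(\<Prod>z\<leftarrow>zip F e. terms_eval a (fst z) ^ snd z) = monomial_eval ?b e"
      using e assms(3) by (simp add: prod.list_conv_set_nth monomial_eval_def atLeast0LessThan)
    moreover have "terms_eval a [(c, map (\<lambda>_. 0) e)] = of_rat c"
      by (simp add: terms_eval_def monomial_eval_def)
    ultimately show ?thesis
      using fold[of "zip F e" "[(c, map (\<lambda>_. 0) e)]"] e by simp
  qed
  have "wf_terms n (psubst F p) \<and> terms_eval a (psubst F p) = terms_eval ?b p"
    using assms(1)
  proof (induction p)
    case (Cons t p)
    then show ?case using mon[of "snd t" "fst t"] by (simp add: terms_eval_def)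
  qed (simp add: terms_eval_def)
  then show "wf_terms n (psubst F p)" "terms_eval a (psubst F p) = terms_eval ?b p" by auto
qed

lemma wf_terms_pprod: "list_all (wf_terms n) hs \<Longrightarrow> wf_terms n (pprod n hs)"
  and sem_pprod: "list_all (wf_terms n) hs \<Longrightarrow> sem (pprod n hs) = prod_list (map sem hs)"
proof -
  have fold: "wf_terms n (fold pmul hs r) \<and> sem (fold pmul hs r) = prod_list (map sem hs) * sem r"
    if "list_all (wf_terms n) hs" "wf_terms n r" for r
    using that
    by (induction hs arbitrary: r)
      (simp_all add: wf_terms_pmul sem_def term_sum_pmul[OF multiplicative_sem, where n = n] mult.left_commute mult.commute)
  have "Poly_Mapping.nth (replicate n 0) = (0 :: nat \<Rightarrow>\<^sub>0 nat)"
    by (rule poly_mapping_eqI) (simp add: nth_default_def)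
  then have "sem [(1, replicate n 0)] = 1" by (simp add: sem_def)
  then show "list_all (wf_terms n) hs \<Longrightarrow> wf_terms n (pprod n hs)"
    "list_all (wf_terms n) hs \<Longrightarrow> sem (pprod n hs) = prod_list (map sem hs)"
    using fold[of "[(1, replicate n 0)]"] by (auto simp: pprod_def)
qed

section \<open>Loops and certificates\<close>

lemma mpolys_mult:
  fixes p q :: "'a::comm_semiring_1 mpoly"
  assumes "p \<in> mpolys n" "q \<in> mpolys n"
  shows "p * q \<in> mpolys n"
  unfolding mpolys_def
proof (intro CollectI ballI)
  fix m assume "m \<in> Poly_Mapping.keys (p * q)"
  then obtain k l where "m = k + l" "k \<in> Poly_Mapping.keys p" "l \<in> Poly_Mapping.keys q"
    using keys_mult[of p q] by blast
  then show "Poly_Mapping.keys m \<subseteq> {..<n}"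
    using assms keys_add[of k l] unfolding mpolys_def by blast
qed

lemma mpolys_add:
  assumes "p \<in> mpolys n" "q \<in> mpolys n"
  shows "p + q \<in> mpolys n"
  using assms keys_add[of p q] unfolding mpolys_def by auto

lemma mpolys_sum:
  assumes "\<And>i. i \<in> I \<Longrightarrow> p i \<in> mpolys n"
  shows "sum p I \<in> mpolys n"
  using assms by (induction I rule: infinite_finite_induct) (auto simp: mpolys_add, auto simp: mpolys_def)

lemma mpolys_uminus: "(p :: 'a::ab_group_add mpoly) \<in> mpolys n \<Longrightarrow> - p \<in> mpolys n"
  by (simp add: mpolys_def in_keys_iff)

lemma mpoly_code_sem: "wf_terms n ts \<Longrightarrow> mpoly_code n (sem ts) (enc ts)"
  by (auto simp: mpoly_code_iff)

section \<open>Rows of a loop and the conditions they impose\<close>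

locale loop_terms =
  fixes n :: nat and gs hs :: "terms list" and Fs :: "terms list list"
  assumes wf_gs: "list_all (wf_terms n) gs"
    and wf_hs: "list_all (wf_terms n) hs"
    and wf_Fs: "F \<in> set Fs \<Longrightarrow> length F = n \<and> list_all (wf_terms n) F"
begin

abbreviation "h \<equiv> pprod n hs"

definition R :: "nat \<Rightarrow> terms list list" where
  "R = input_rows (n, gs, hs, Fs)"

lemma R_0: "R 0 = [gs]"
  and R_Suc: "R (Suc N) = gs # concat (map (\<lambda>F. map (map (\<lambda>p. pmul h (psubst F p))) (R N)) Fs)"
  by (simp_all add: R_def input_rows_def rows_upto_def next_rows_def)

lemma set_R_Suc: "set (R (Suc N)) = insert gs (\<Union>F\<in>set Fs. (map (\<lambda>p. pmul h (psubst F p))) ` set (R N))"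
  by (simp add: R_Suc)

lemma R_rows: "r \<in> set (R N) \<Longrightarrow> length r = length gs \<and> list_all (wf_terms n) r"
proof (induction N arbitrary: r)
  case 0
  then show ?case using wf_gs by (simp add: R_0)
next
  case (Suc N)
  then consider "r = gs" | F r' where "F \<in> set Fs" "r' \<in> set (R N)" "r = map (\<lambda>p. pmul h (psubst F p)) r'"
    by (auto simp: set_R_Suc)
  then show ?case
  proof cases
    case 2
    then show ?thesis
      using Suc.IH[of r'] wf_Fs[of F] wf_terms_pprod[OF wf_hs]
      by (auto simp: list_all_iff intro!: wf_terms_pmul wf_terms_psubst)
  qed (use wf_gs in simp)
qed

lemma R_mono: "set (R N) \<subseteq> set (R (Suc N))"
proof (induction N)
  case (Suc N)
  have "set (R (Suc M)) \<subseteq> set (R (Suc K))" if "set (R M) \<subseteq> set (R K)" for M K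
    unfolding set_R_Suc by (intro insert_mono UN_mono image_mono that subset_refl)
  then show ?case using Suc.IH by blast
qed (simp add: R_0 set_R_Suc)

definition form :: "(nat \<Rightarrow> complex) \<Rightarrow> complex vec \<Rightarrow> terms list \<Rightarrow> complex" where
  "form b a r = (\<Sum>l<length gs. b l * terms_eval a (r ! l))"

definition vanishes :: "(nat \<Rightarrow> complex) \<Rightarrow> nat \<Rightarrow> complex vec \<Rightarrow> bool" where
  "vanishes b N a \<longleftrightarrow> (\<forall>r \<in> set (R N). form b a r = 0)"

definition move :: "terms list \<Rightarrow> complex vec \<Rightarrow> complex vec" where
  "move F a = vec n (\<lambda>j. terms_eval a (F ! j))"

lemma vanishes_0: "vanishes b 0 a \<longleftrightarrow> form b a gs = 0"
  by (simp add: vanishes_def R_0)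

lemma form_map:
  assumes "r \<in> set (R N)" "F \<in> set Fs"
  shows "form b a (map (\<lambda>p. pmul h (psubst F p)) r) = terms_eval a h * form b (move F a) r"
proof -
  have "terms_eval a (pmul h (psubst F (r ! l))) = terms_eval a h * terms_eval (move F a) (r ! l)"
    if "l < length gs" for l
  proof -
    have wf: "wf_terms n (r ! l)" using R_rows[OF assms(1)] that by (auto simp: list_all_length)
    have "terms_eval a (pmul h (psubst F (r ! l))) = terms_eval a h * terms_eval a (psubst F (r ! l))"
      unfolding terms_eval_def using wf_Fs[OF assms(2)] wf
      by (intro term_sum_pmul[OF multiplicative_eval wf_terms_pprod[OF wf_hs]] wf_terms_psubst) auto
    then show ?thesis
      using wf_Fs[OF assms(2)] wf by (simp add: terms_eval_psubst move_def)
  qed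
  then show ?thesis
    using R_rows[OF assms(1)] by (auto simp: form_def sum_distrib_left mult.left_commute intro!: sum.cong)
qed

text \<open>All rows of nonempty words carry the factor \<open>h\<close> at the starting point. Once
  it is split off, a first step \<open>F\<close> leaves the same condition one level lower at the
  moved point.\<close>

lemma vanishes_Suc:
  "vanishes b (Suc N) a \<longleftrightarrow>
    form b a gs = 0 \<and> (\<forall>F \<in> set Fs. terms_eval a h = 0 \<or> vanishes b N (move F a))"
  by (auto simp: vanishes_def set_R_Suc form_map)

lemma vanishes_words:
  "vanishes b N a \<longleftrightarrow> (\<forall>is. length is \<le> N \<and> set is \<subseteq> {..<length Fs} \<longrightarrow>
     form b (fold (\<lambda>i. move (Fs ! i)) is a) gs = 0 \<or>
     (\<exists>l<length is. terms_eval (fold (\<lambda>i. move (Fs ! i)) (take l is) a) h = 0))"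
proof (induction N arbitrary: a)
  case 0
  then show ?case by (simp add: vanishes_0)
next
  case (Suc N)
  let ?f = "fold (\<lambda>i. move (Fs ! i))"
  let ?P = "\<lambda>is a. form b (?f is a) gs = 0 \<or> (\<exists>l<length is. terms_eval (?f (take l is) a) h = 0)"
  have Cons: "?P (i # is) a \<longleftrightarrow> terms_eval a h = 0 \<or> ?P is (move (Fs ! i) a)" for i "is"
  proof -
    have "(\<exists>l<length (i # is). terms_eval (?f (take l (i # is)) a) h = 0) \<longleftrightarrow>
        terms_eval a h = 0 \<or> (\<exists>l<length is. terms_eval (?f (take l is) (move (Fs ! i) a)) h = 0)"
      unfolding length_Cons Ex_less_Suc2 by simp
    then show ?thesis by auto
  qed
  have "(\<forall>is. length is \<le> Suc N \<and> set is \<subseteq> {..<length Fs} \<longrightarrow> ?P is a) \<longleftrightarrow>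
      ?P [] a \<and> (\<forall>i<length Fs. \<forall>is. length is \<le> N \<and> set is \<subseteq> {..<length Fs} \<longrightarrow> ?P (i # is) a)"
    (is "?L \<longleftrightarrow> ?R")
  proof
    assume ?L
    show ?R
    proof (intro conjI allI impI)
      show "?P [] a" using \<open>?L\<close>[rule_format, of "[]"] by simp
      show "?P (i # is) a" if "i < length Fs" "length is \<le> N \<and> set is \<subseteq> {..<length Fs}" for i "is"
        using that by (intro \<open>?L\<close>[rule_format]) simp
    qed
  next
    assume ?R
    show ?L
    proof (intro allI impI)
      fix "is" assume "length is \<le> Suc N \<and> set is \<subseteq> {..<length Fs}"
      then show "?P is a"
        using \<open>?R\<close>[THEN conjunct1] \<open>?R\<close>[THEN conjunct2, rule_format, of "hd is" "tl is"]
        by (cases "is") simp_all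
    qed
  qed
  also have "\<dots> \<longleftrightarrow> form b a gs = 0 \<and> (\<forall>i<length Fs. terms_eval a h = 0 \<or> vanishes b N (move (Fs ! i) a))"
  proof -
    \<comment> \<open>Whether \<open>h\<close> vanishes at \<open>a\<close> does not depend on the
      rest of the word, so this disjunct leaves the quantifier and the induction hypothesis applies
      at the moved point.\<close>
    have "(\<forall>x. C x \<longrightarrow> A \<or> Q x) \<longleftrightarrow> A \<or> (\<forall>x. C x \<longrightarrow> Q x)" for C Q :: "nat list \<Rightarrow> bool" and A
      by blast
    then show ?thesis
      unfolding Suc.IH Cons by simp
  qed
  also have "\<dots> \<longleftrightarrow> vanishes b (Suc N) a"
    unfolding vanishes_Suc by (auto simp: all_set_conv_all_nth)
  finally show ?case by simp
qed

text \<open>The zero test gives an identity over the rationals, which is evaluated at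
  \<open>a\<close> and paired with \<open>b\<close>. Exchanging the sums over columns and rows
  writes \<open>form b a r\<close> as a combination of forms that vanish by assumption.\<close>

lemma certifies_vanishes_Suc:
  assumes "certifies (n, gs, hs, Fs) (N, ys)" "vanishes b N a"
  shows "vanishes b (Suc N) a"
  unfolding vanishes_def
proof
  fix r assume r: "r \<in> set (R (Suc N))"
  then obtain qs where qs: "is_syzygy n (R N) r qs"
    using assms(1) by (auto simp: certifies_def R_def list_all_iff list_ex_iff)
  have swap: "(\<Sum>l<length gs. \<Sum>z\<leftarrow>zs. terms_eval a (fst z) * (b l * terms_eval a (snd z ! l)))
      = (\<Sum>z\<leftarrow>zs. terms_eval a (fst z) * form b a (snd z))" for zs :: "(terms \<times> terms list) list"
    by (induction zs) (simp_all add: form_def sum.distrib sum_distrib_left)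
  let ?w = "add_combination qs (R N) r"
  have "length ?w = length gs"
    using R_rows r by (intro length_add_combination) auto
  have "terms_eval a (r ! l) = - (\<Sum>z\<leftarrow>zip qs (R N). terms_eval a (fst z) * terms_eval a (snd z ! l))"
    if l: "l < length gs" for l
  proof -
    have prems: "\<forall>row \<in> set (R N). length row = length gs \<and> list_all (wf_terms n) row"
        "list_all (wf_terms n) qs" "length r = length gs" "list_all (wf_terms n) r"
      using R_rows r qs by (auto simp: is_syzygy_def)
    have "is_zero (?w ! l)"
      using qs l \<open>length ?w = length gs\<close> by (simp add: is_syzygy_def list_all_length)
    then have "sem (?w ! l) = 0"
      using is_zero_iff add_combination_nth(1)[OF prems l multiplicative_sem] by blast
    then have "terms_eval a (?w ! l) = 0"
      using mpoly_eval_cpoly_sem[of "?w ! l" a] mpoly_eval_cpoly_sem[of "[]" a] by (simp add: sem_def terms_eval_def)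
    then show ?thesis
      using add_combination_nth(2)[OF prems l multiplicative_eval, of a]
      by (simp add: terms_eval_def add_eq_0_iff2)
  qed
  then have "form b a r = - (\<Sum>l<length gs. \<Sum>z\<leftarrow>zip qs (R N). terms_eval a (fst z) * (b l * terms_eval a (snd z ! l)))"
    by (simp add: form_def sum_negf[symmetric] sum_list_const_mult[symmetric] mult.left_commute)
  also have "(\<Sum>l<length gs. \<Sum>z\<leftarrow>zip qs (R N). terms_eval a (fst z) * (b l * terms_eval a (snd z ! l)))
      = (\<Sum>z\<leftarrow>zip qs (R N). terms_eval a (fst z) * form b a (snd z))"
    by (rule swap)
  also have "\<dots> = 0"
  proof -
    have eq: "map (\<lambda>z. terms_eval a (fst z) * form b a (snd z)) (zip qs (R N)) = map (\<lambda>_. 0) (zip qs (R N))"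
      using assms(2) by (auto simp: vanishes_def dest: set_zip_rightD)
    show ?thesis by (simp only: eq sum_list_0)
  qed
  finally show "form b a r = 0" by simp
qed

lemma certifies_vanishes_all:
  assumes cert: "certifies (n, gs, hs, Fs) (N, ys)"
  shows "vanishes b N a \<longleftrightarrow> (\<forall>K. vanishes b K a)"
proof
  \<comment> \<open>The point stays arbitrary. Level \<open>Suc N\<close> at \<open>a\<close>
    provides level \<open>N\<close> at each \<open>move F a\<close> unless \<open>h\<close> vanishes
    at \<open>a\<close>; the induction hypothesis raises this to \<open>K + N\<close> there, which
    is level \<open>Suc (K + N)\<close> at \<open>a\<close>.\<close>
  have add: "vanishes b N a \<Longrightarrow> vanishes b (K + N) a" for K a
  proof (induction K arbitrary: a)
    case (Suc K)
    from certifies_vanishes_Suc[OF cert Suc.prems] Suc.IH show ?case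
      by (auto simp: vanishes_Suc)
  qed simp
  have antimono: "vanishes b K' a" if "vanishes b K a" "K' \<le> K" for K K' a
    using that by (auto simp: vanishes_words)
  show "\<forall>K. vanishes b K a" if "vanishes b N a"
    using antimono[OF add[OF that]] by (meson le_add1)
qed simp

section \<open>Modules generated by the rows and existence of certificates\<close>

definition row_module :: "nat \<Rightarrow> (nat \<Rightarrow> rat mpoly) set" where
  "row_module N = {(\<lambda>l. \<Sum>j<length (R N). q j * (if l < length gs then sem (R N ! j ! l) else 0)) | q.
     \<forall>j. q j \<in> mpolys n}"

lemma row_module_ascending: "row_module N \<subseteq> row_module (Suc N)"
proof
  \<comment> \<open>Padding with 0 makes rows total functions with bounded support, as the
    stabilisation theorem expects, and avoids \<open>!\<close> beyond the end of a row.\<close>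
  let ?R = "\<lambda>N j l. if l < length gs then sem (R N ! j ! l) else 0"
  fix f assume "f \<in> row_module N"
  then obtain q where q: "f = (\<lambda>l. \<Sum>j<length (R N). q j * ?R N j l)" "\<And>j. q j \<in> mpolys n"
    unfolding row_module_def by blast
  have "\<forall>j. j < length (R N) \<longrightarrow> (\<exists>i<length (R (Suc N)). R (Suc N) ! i = R N ! j)"
    using R_mono by (metis in_set_conv_nth subset_iff)
  then obtain \<sigma> where \<sigma>: "\<And>j. j < length (R N) \<Longrightarrow> \<sigma> j < length (R (Suc N)) \<and> R (Suc N) ! \<sigma> j = R N ! j"
    by metis
  \<comment> \<open>Rows may repeat, so \<sigma> need not be injective; the cofactors over one fibre
    are added.\<close>
  define q' where "q' i = (\<Sum>j\<in>{j\<in>{..<length (R N)}. \<sigma> j = i}. q j)" for i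
  have "f l = (\<Sum>i<length (R (Suc N)). q' i * ?R (Suc N) i l)" for l
  proof -
    have "f l = (\<Sum>j<length (R N). q j * ?R (Suc N) (\<sigma> j) l)"
      using q(1) \<sigma> by (auto intro!: sum.cong)
    also have "\<dots> = (\<Sum>i<length (R (Suc N)). \<Sum>j\<in>{j\<in>{..<length (R N)}. \<sigma> j = i}. q j * ?R (Suc N) (\<sigma> j) l)"
      by (rule sum.group[symmetric]) (use \<sigma> in auto)
    also have "\<dots> = (\<Sum>i<length (R (Suc N)). q' i * ?R (Suc N) i l)"
      unfolding q'_def sum_distrib_right by (auto intro!: sum.cong)
    finally show ?thesis .
  qed
  moreover have "q' i \<in> mpolys n" for i
    unfolding q'_def by (intro mpolys_sum q(2))
  ultimately show "f \<in> row_module (Suc N)"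
    unfolding row_module_def by blast
qed

lemma row_module_stabilises: "\<exists>N. row_module (Suc N) = row_module N"
proof (rule ascending_submodules_stabilise[where n = n and M = "length gs"])
  fix N f l
  assume "f \<in> row_module N"
  then obtain q where q: "f = (\<lambda>l. \<Sum>j<length (R N). q j * (if l < length gs then sem (R N ! j ! l) else 0))"
      "\<And>j. q j \<in> mpolys n"
    unfolding row_module_def by blast
  have "sem (R N ! j ! l) \<in> mpolys n" if "j < length (R N)" "l < length gs" for j
    using R_rows[OF nth_mem[OF that(1)]] that(2) by (auto simp: list_all_length intro: sem_mpolys)
  then show "f l \<in> mpolys n"
    unfolding q(1) by (intro mpolys_sum mpolys_mult q(2)) (auto simp: mpolys_def)
  show "f l = 0" if "length gs \<le> l"
    using that by (simp add: q(1))
next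
  show "(\<lambda>_. 0) \<in> row_module N" for N
    unfolding row_module_def by (intro CollectI exI[of _ "\<lambda>_. 0"]) (simp add: mpolys_def)
next
  fix N f g d and c :: rat
  assume "f \<in> row_module N" "g \<in> row_module N" and d: "d \<in> monomials n"
  then obtain q q' where
    q: "f = (\<lambda>l. \<Sum>j<length (R N). q j * (if l < length gs then sem (R N ! j ! l) else 0))" "\<And>j. q j \<in> mpolys n" and
    q': "g = (\<lambda>l. \<Sum>j<length (R N). q' j * (if l < length gs then sem (R N ! j ! l) else 0))" "\<And>j. q' j \<in> mpolys n"
    unfolding row_module_def by blast
  have "q j + Poly_Mapping.single d c * q' j \<in> mpolys n" for j
    by (intro mpolys_add mpolys_mult q(2) q'(2)) (use d in \<open>simp add: mpolys_def\<close>)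
  then show "(\<lambda>l. f l + Poly_Mapping.single d c * g l) \<in> row_module N"
    unfolding row_module_def
    by (intro CollectI exI[of _ "\<lambda>j. q j + Poly_Mapping.single d c * q' j"])
      (simp add: q(1) q'(1) sum.distrib sum_distrib_left distrib_right mult.assoc)
qed (rule row_module_ascending)

lemma certificate_exists: "\<exists>y. certifies (n, gs, hs, Fs) y"
proof -
  obtain N where N: "row_module (Suc N) = row_module N"
    using row_module_stabilises by blast
  have "\<exists>qs. is_syzygy n (R N) r (map terms_of qs)" if r: "r \<in> set (R (Suc N))" for r
  proof -
    let ?R = "\<lambda>N j l. if l < length gs then sem (R N ! j ! l) else 0"
    obtain i where i: "i < length (R (Suc N))" "R (Suc N) ! i = r"
      using r by (metis in_set_conv_nth)
    have "(\<lambda>l. ?R (Suc N) i l) = (\<lambda>l. \<Sum>j<length (R (Suc N)). (if j = i then 1 else 0) * ?R (Suc N) j l)"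
      using i(1) by (simp add: if_distrib[of "\<lambda>x. x * _"] cong: if_cong)
    moreover have "(if j = i then 1 else 0) \<in> mpolys n" for j
      by (simp add: mpolys_def)
    ultimately have "(\<lambda>l. ?R (Suc N) i l) \<in> row_module (Suc N)"
      unfolding row_module_def by (intro CollectI exI[of _ "\<lambda>j. if j = i then 1 else 0"] conjI allI)
    then have "(\<lambda>l. ?R (Suc N) i l) \<in> row_module N"
      by (simp only: N)
    then obtain q where q: "(\<lambda>l. ?R (Suc N) i l) = (\<lambda>l. \<Sum>j<length (R N). q j * ?R N j l)" "\<And>j. q j \<in> mpolys n"
      unfolding row_module_def by blast
    \<comment> \<open>The sign makes \<open>add_combination\<close>, which starts from
      \<open>r\<close>, cancel to zero.\<close>
    have "\<forall>j. \<exists>c. wf_terms n (terms_of c) \<and> sem (terms_of c) = - q j"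
      using cofactor_exists mpolys_uminus q(2) by metis
    then obtain c where c: "\<And>j. wf_terms n (terms_of (c j))" "\<And>j. sem (terms_of (c j)) = - q j"
      by metis
    let ?qs = "map terms_of (map c [0..<length (R N)])"
    have prems: "\<forall>row \<in> set (R N). length row = length gs \<and> list_all (wf_terms n) row"
        "list_all (wf_terms n) ?qs" "length r = length gs" "list_all (wf_terms n) r"
      using R_rows r c(1) by (auto simp: list_all_iff)
    let ?w = "add_combination ?qs (R N) r"
    have len: "length ?w = length gs"
      using prems by (intro length_add_combination) auto
    have "is_zero (?w ! l)" if l: "l < length gs" for l
    proof -
      have "(\<Sum>z\<leftarrow>zip ?qs (R N). sem (fst z) * sem (snd z ! l)) = (\<Sum>j<length (R N). - q j * sem (R N ! j ! l))"
        by (simp add: sum_list_sum_nth atLeast0LessThan c(2))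
      also have "\<dots> = - sem (r ! l)"
        using fun_cong[OF q(1), of l] l i(2) by (simp add: sum_negf)
      finally have "sem (?w ! l) = 0"
        using add_combination_nth(2)[OF prems l multiplicative_sem] by (simp add: sem_def)
      then show ?thesis
        using is_zero_iff add_combination_nth(1)[OF prems l multiplicative_sem] by blast
    qed
    then have "is_syzygy n (R N) r ?qs"
      using prems(2) len by (simp add: is_syzygy_def list_all_length)
    then show ?thesis by blast
  qed
  then obtain qs where "\<And>r. r \<in> set (R (Suc N)) \<Longrightarrow> is_syzygy n (R N) r (map terms_of (qs r))" by metis
  then have "certifies (n, gs, hs, Fs) (N, map qs (R (Suc N)))"
    by (auto simp: certifies_def R_def list_all_iff list_ex_iff)
  then show ?thesis by blast
qed

section \<open>From invariants to vanishing rows\<close>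

definition combination :: "(nat \<Rightarrow> complex) \<Rightarrow> complex mpoly" where
  "combination b = (\<Sum>l<length gs. mpoly_scale (b l) (cpoly (sem (gs ! l))))"

lemma mpoly_eval_combination: "mpoly_eval (combination b) a = form b a gs"
  by (simp add: combination_def form_def mpoly_eval_sum mpoly_eval_scale mpoly_eval_cpoly_sem)

lemma branch_eq:
  assumes "set is \<subseteq> {..<length Fs}"
  shows "branch (map (map sem) Fs) is a = fold (\<lambda>i. move (Fs ! i)) is a"
  unfolding branch_def
proof (rule List.fold_cong)
  fix i assume "i \<in> set is"
  then have "i < length Fs" using assms by auto
  then have "length (Fs ! i) = n" using wf_Fs by simp
  with \<open>i < length Fs\<close> show "polymap (map (map sem) Fs ! i) = move (Fs ! i)"
    by (auto simp: polymap_def move_def mpoly_eval_cpoly_sem fun_eq_iff intro!: eq_vecI)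
qed auto

text \<open>By \<open>vanishes_words\<close> the right side treats each word separately: the
  combination vanishes at its end, or \<open>h\<close> vanishes at a proper prefix. Applied to all
  prefixes of a word, this recovers the definition, which asks for zeros at every prefix up to some
  exit.\<close>

lemma poly_invariant_iff:
  "poly_invariant a (map sem hs) (map (map sem) Fs) (combination b) \<longleftrightarrow> (\<forall>K. vanishes b K a)"
proof -
  let ?f = "fold (\<lambda>i. move (Fs ! i))"
  let ?G = "\<lambda>is. form b (?f is a) gs = 0" and ?H = "\<lambda>is. terms_eval (?f is a) h = 0"
  have take_words: "set (take l is) \<subseteq> {..<length Fs}" if "set is \<subseteq> {..<length Fs}" for l "is"
    using that set_take_subset by (rule subset_trans[rotated])
  have "poly_invariant a (map sem hs) (map (map sem) Fs) (combination b) \<longleftrightarrow> ?G [] \<and>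
      (\<forall>is. set is \<subseteq> {..<length Fs} \<longrightarrow> (\<forall>j\<in>{1..length is}. ?G (take j is)) \<or>
        (\<exists>l<length is. (\<forall>j\<in>{1..l}. ?G (take j is)) \<and> ?H (take l is)))"
    unfolding poly_invariant_def
    by (simp add: mpoly_eval_combination branch_eq take_words sem_pprod[OF wf_hs, symmetric] mpoly_eval_cpoly_sem cong: imp_cong)
  also have "\<dots> \<longleftrightarrow> (\<forall>is. set is \<subseteq> {..<length Fs} \<longrightarrow> ?G is \<or> (\<exists>l<length is. ?H (take l is)))"
    (is "?L \<longleftrightarrow> ?R")
  proof
    assume L: ?L
    show ?R
    proof (intro allI impI)
      fix "is" assume "set is \<subseteq> {..<length Fs}"
      with L have "(\<forall>j\<in>{1..length is}. ?G (take j is)) \<or> (\<exists>l<length is. ?H (take l is))"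
        by blast
      then show "?G is \<or> (\<exists>l<length is. ?H (take l is))"
      proof
        assume *: "\<forall>j\<in>{1..length is}. ?G (take j is)"
        have "?G is"
        proof (cases "is = []")
          case True
          then show ?thesis using L by simp
        next
          case False
          then have "length is \<in> {1..length is}" by (cases "is") auto
          then show ?thesis using * by fastforce
        qed
        then show ?thesis ..
      qed simp
    qed
  next
    assume R: ?R
    have prefix: "?G (take j is)" if "set is \<subseteq> {..<length Fs}" "j \<le> length is" "\<And>l. l < j \<Longrightarrow> \<not> ?H (take l is)" for j "is"
    proof -
      have "?G (take j is) \<or> (\<exists>l<length (take j is). ?H (take l (take j is)))"
        using R take_words[OF that(1)] by blast
      moreover have "length (take j is) = j" "\<And>l. l < j \<Longrightarrow> take l (take j is) = take l is"
        using that(2) by (simp_all add: min_def)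
      ultimately show ?thesis using that(3) by metis
    qed
    show ?L
    proof (intro conjI allI impI)
      show "?G []" using R[rule_format, of "[]"] by simp
      fix "is" assume w: "set is \<subseteq> {..<length Fs}"
      show "(\<forall>j\<in>{1..length is}. ?G (take j is)) \<or> (\<exists>l<length is. (\<forall>j\<in>{1..l}. ?G (take j is)) \<and> ?H (take l is))"
      proof (cases "\<exists>l<length is. ?H (take l is)")
        case True
        \<comment> \<open>The exit must be the earliest one: a zero of the combination at a prefix
          is forced only while \<open>h\<close> is nonzero at all shorter prefixes.\<close>
        define l where "l = (LEAST l. ?H (take l is))"
        have "?H (take l is)" unfolding l_def using True by (auto intro: LeastI)
        moreover have below: "\<not> ?H (take l' is)" if "l' < l" for l'
          using that unfolding l_def by (rule not_less_Least)
        moreover have "l < length is"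
          using True Least_le[of "\<lambda>l. ?H (take l is)"] unfolding l_def by (meson le_less_trans)
        ultimately show ?thesis
          using prefix[OF w] by (intro disjI2 exI[of _ l]) auto
      next
        case False
        then show ?thesis using prefix[OF w] by auto
      qed
    qed
  qed
  also have "\<dots> \<longleftrightarrow> (\<forall>K. vanishes b K a)"
    unfolding vanishes_words by blast
  finally show ?thesis .
qed

end

text \<open>Coefficients belong to positions in the list, so repeated generators are allowed and the
  coefficients can become the entries of a kernel vector.\<close>

lemma span_cpoly:
  "cmpoly.span (cpoly ` set gs) = {(\<Sum>i<length gs. mpoly_scale (b i) (cpoly (gs ! i))) | b. True}"
  (is "_ = ?T")
proof
  have "cmpoly.subspace ?T"
  proof (rule cmpoly.subspaceI)
    show "0 \<in> ?T"
      by (intro CollectI exI[of _ "\<lambda>_. 0"]) simp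
  next
    fix x y assume "x \<in> ?T" "y \<in> ?T"
    then obtain b b' where "x = (\<Sum>i<length gs. mpoly_scale (b i) (cpoly (gs ! i)))"
      "y = (\<Sum>i<length gs. mpoly_scale (b' i) (cpoly (gs ! i)))" by blast
    then show "x + y \<in> ?T"
      by (intro CollectI exI[of _ "\<lambda>i. b i + b' i"]) (simp add: sum.distrib cmpoly.scale_left_distrib)
  next
    fix c x assume "x \<in> ?T"
    then obtain b where "x = (\<Sum>i<length gs. mpoly_scale (b i) (cpoly (gs ! i)))" by blast
    then show "mpoly_scale c x \<in> ?T"
      by (intro CollectI exI[of _ "\<lambda>i. c * b i"]) (simp add: cmpoly.scale_sum_right)
  qed
  moreover have "cpoly ` set gs \<subseteq> ?T"
  proof
    fix x assume "x \<in> cpoly ` set gs"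
    then obtain j where "j < length gs" "x = cpoly (gs ! j)" by (auto simp: in_set_conv_nth)
    then show "x \<in> ?T"
      by (intro CollectI exI[of _ "\<lambda>i. if i = j then 1 else 0"])
        (simp add: if_distrib[of "\<lambda>x. mpoly_scale x _"] cong: if_cong)
  qed
  ultimately show "cmpoly.span (cpoly ` set gs) \<subseteq> ?T" by (rule cmpoly.span_minimal[rotated])
  show "?T \<subseteq> cmpoly.span (cpoly ` set gs)"
  proof safe
    fix b :: "nat \<Rightarrow> complex"
    show "(\<Sum>i<length gs. mpoly_scale (b i) (cpoly (gs ! i))) \<in> cmpoly.span (cpoly ` set gs)"
      by (rule cmpoly.span_sum, rule cmpoly.span_scale, rule cmpoly.span_base) auto
  qed
qed

lemma mpolys_cpoly: "p \<in> mpolys n \<Longrightarrow> cpoly p \<in> mpolys n"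
  by (auto simp: mpolys_def cpoly_def in_keys_iff map.rep_eq when_def split: if_splits)

lemma mpolys_scale: "p \<in> mpolys n \<Longrightarrow> mpoly_scale c p \<in> mpolys n"
  by (auto simp: mpolys_def mpoly_scale_def in_keys_iff map.rep_eq when_def split: if_splits)

section \<open>The output matrix and its kernel\<close>

context loop_terms
begin

definition out_matrix :: "nat \<Rightarrow> rat mpoly mat" where
  "out_matrix N = mat_of_rows_list (length gs) (map (map sem) (R N))"

lemma out_matrix_dim [simp]: "dim_row (out_matrix N) = length (R N)" "dim_col (out_matrix N) = length gs"
  by (simp_all add: out_matrix_def mat_of_rows_list_def)

lemma out_matrix_index:
  "i < length (R N) \<Longrightarrow> l < length gs \<Longrightarrow> out_matrix N $$ (i, l) = sem (R N ! i ! l)"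
  using R_rows[of "R N ! i" N] by (simp add: out_matrix_def mat_of_rows_list_def)

lemma out_matrix_mpolys: "elements_mat (out_matrix N) \<subseteq> mpolys n"
proof
  fix p assume "p \<in> elements_mat (out_matrix N)"
  then obtain i l where "i < length (R N)" "l < length gs" "p = out_matrix N $$ (i, l)"
    by (auto simp: elements_mat_def)
  then show "p \<in> mpolys n"
    using R_rows[of "R N ! i" N] by (auto simp: out_matrix_index list_all_length intro!: sem_mpolys)
qed

text \<open>\<open>mpoly_code\<close> accepts unsorted and repeated terms, so the computed rows are
  output without normalisation.\<close>

lemma out_matrix_code:
  "matrix_code n (out_matrix N) (list_encode [length (R N), length gs, enc (R N)])"
proof -
  have "mat_to_list (out_matrix N) = map (map sem) (R N)"
    using R_rows[of _ N]
    by (auto simp: mat_to_list_def out_matrix_index intro!: nth_equalityI)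
  moreover have "list_all2 (list_all2 (mpoly_code n)) (map (map sem) (R N)) (map (map enc) (R N))"
    using R_rows[of _ N]
    by (auto simp: list.rel_map mpoly_code_sem list_all_iff intro!: list.rel_refl_strong)
  moreover have "enc (R N) = list_encode (map list_encode (map (map enc) (R N)))"
    by (simp add: enc_list_def[abs_def] o_def)
  ultimately show ?thesis
    unfolding matrix_code_def by (intro exI[of _ "map (map enc) (R N)"]) simp
qed

lemma out_matrix_kernel:
  "b \<in> mat_kernel (map_mat (\<lambda>p. mpoly_eval (cpoly p) a) (out_matrix N)) \<longleftrightarrow>
   b \<in> carrier_vec (length gs) \<and> vanishes (\<lambda>l. b $ l) N a"
proof -
  let ?A = "map_mat (\<lambda>p. mpoly_eval (cpoly p) a) (out_matrix N)"
  have "(?A *\<^sub>v b) $ i = form (\<lambda>l. b $ l) a (R N ! i)"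
    if "b \<in> carrier_vec (length gs)" "i < length (R N)" for i
    using that by (auto simp: scalar_prod_def form_def atLeast0LessThan out_matrix_index
        mpoly_eval_cpoly_sem mult.commute intro!: sum.cong)
  then have "?A *\<^sub>v b = 0\<^sub>v (length (R N)) \<longleftrightarrow> (\<forall>i<length (R N). form (\<lambda>l. b $ l) a (R N ! i) = 0)"
    if "b \<in> carrier_vec (length gs)"
    using that by (auto simp: vec_eq_iff)
  then show ?thesis
    by (auto simp: mat_kernel_def vanishes_def all_set_conv_all_nth)
qed

lemma invariants_eq_kernel:
  assumes "certifies (n, gs, hs, Fs) (N, ys)" "a \<in> carrier_vec n"
  shows "invariants_in (cmpoly.span (cpoly ` set (map sem gs))) a (map sem hs) (map (map sem) Fs) =
    {(\<Sum>i<length (map sem gs). mpoly_scale (b $ i) (cpoly (map sem gs ! i))) | b.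
      b \<in> mat_kernel (map_mat (\<lambda>p. mpoly_eval (cpoly p) a) (out_matrix N))}" (is "?L = ?R")
proof -
  have comb: "(\<Sum>i<length (map sem gs). mpoly_scale (b i) (cpoly (map sem gs ! i))) = combination b" for b
    by (simp add: combination_def)
  have mpolys: "combination b \<in> mpolys n" for b
    unfolding combination_def using wf_gs
    by (intro mpolys_sum mpolys_scale mpolys_cpoly sem_mpolys) (simp add: list_all_length)
  have inv: "poly_invariant a (map sem hs) (map (map sem) Fs) (combination b) \<longleftrightarrow> vanishes b N a" for b
    unfolding poly_invariant_iff certifies_vanishes_all[OF assms(1)] ..
  have "?L = {combination b | b. vanishes b N a}"
  proof -
    have "cmpoly.span (cpoly ` set (map sem gs)) = {combination b | b. True}"
      unfolding span_cpoly comb ..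
    then show ?thesis
      using assms(2) by (auto simp: invariants_in_def mpolys inv simp del: set_map image_set)
  qed
  \<comment> \<open>Only coefficients below \<open>length gs\<close> enter, so a coefficient
    function can be cut down to a vector of that length.\<close>
  also have "\<dots> = {combination (\<lambda>l. b $ l) | b. b \<in> carrier_vec (length gs) \<and> vanishes (\<lambda>l. b $ l) N a}"
  proof (intro Collect_cong iffI)
    fix g assume "\<exists>b. g = combination b \<and> vanishes b N a"
    then obtain b where b: "g = combination b" "vanishes b N a" by blast
    have "combination (\<lambda>l. vec (length gs) b $ l) = combination b"
      by (simp add: combination_def)
    moreover have "vanishes (\<lambda>l. vec (length gs) b $ l) N a = vanishes b N a"
      by (simp add: vanishes_def form_def)
    ultimately show "\<exists>b. g = combination (\<lambda>l. b $ l) \<and> b \<in> carrier_vec (length gs) \<and> vanishes (\<lambda>l. b $ l) N a"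
      using b by (intro exI[of _ "vec (length gs) b"]) simp
  qed blast
  also have "\<dots> = ?R"
    unfolding comb out_matrix_kernel ..
  finally show ?thesis .
qed

end

section \<open>Decoding the input and assembling the algorithm\<close>

lemma list_all2_decode:
  assumes "list_all2 P xs ys" "\<And>x y. P x y \<Longrightarrow> \<exists>t. y = e t \<and> x = s t \<and> W t"
  shows "\<exists>ts. ys = map e ts \<and> xs = map s ts \<and> list_all W ts"
  using assms(1)
proof (induction rule: list_all2_induct)
  case (Cons x xs y ys)
  then obtain ts where "ys = map e ts \<and> xs = map s ts \<and> list_all W ts" by blast
  moreover obtain t where "y = e t \<and> x = s t \<and> W t" using assms(2)[OF Cons(1)] by blast
  ultimately show ?case by (intro exI[of _ "t # ts"]) simp
qed simp

text \<open>An input code determines term lists on which the program operates; the given polynomials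
  reappear as their values under \<open>sem\<close>, so the results for \<open>loop_terms\<close>
  transfer to them.\<close>

lemma input_code_decode:
  assumes "input_code n gs hs Fs c"
  obtains gts hts Fts where "c = list_encode [n, enc gts, enc hts, enc Fts]"
    "gs = map sem gts" "hs = map sem hts" "Fs = map (map sem) Fts"
    "list_all (wf_terms n) gts" "list_all (wf_terms n) hts" "list_all (list_all (wf_terms n)) Fts"
proof -
  obtain cg ch cF where c: "c = list_encode [n, list_encode cg, list_encode ch, list_encode (map list_encode cF)]"
    "list_all2 (mpoly_code n) gs cg" "list_all2 (mpoly_code n) hs ch"
    "list_all2 (list_all2 (mpoly_code n)) Fs cF"
    using assms unfolding input_code_def by blast
  have dec: "\<exists>ts. ys = map enc ts \<and> xs = map sem ts \<and> list_all (wf_terms n) ts"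
    if "list_all2 (mpoly_code n) xs ys" for xs ys
    using list_all2_decode[OF that, of enc sem "wf_terms n"] by (auto simp: mpoly_code_iff)
  obtain gts where "cg = map enc gts" "gs = map sem gts" "list_all (wf_terms n) gts" using dec[OF c(2)] by blast
  moreover obtain hts where "ch = map enc hts" "hs = map sem hts" "list_all (wf_terms n) hts" using dec[OF c(3)] by blast
  moreover obtain Fts where "cF = map (map enc) Fts" "Fs = map (map sem) Fts" "list_all (list_all (wf_terms n)) Fts"
    using list_all2_decode[OF c(4) dec] by blast
  ultimately show ?thesis
    using c(1) by (intro that[of gts hts Fts]) (simp_all add: enc_list_def[abs_def] o_def)
qed

theorem theorem4p18:
  shows "\<exists>alg :: recf.
    \<forall>(n :: nat) (gs :: rat mpoly list) (hs :: rat mpoly list) (Fs :: rat mpoly list list) (c :: nat).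
      set gs \<subseteq> mpolys n \<and> set hs \<subseteq> mpolys n \<and>
      (\<forall>F \<in> set Fs. length F = n \<and> set F \<subseteq> mpolys n) \<and>
      input_code n gs hs Fs c \<longrightarrow>
      (\<exists>(A :: rat mpoly mat) (d :: nat).
        computes alg [c] d \<and> matrix_code n A d \<and>
        elements_mat A \<subseteq> mpolys n \<and> dim_col A = length gs \<and>
        (\<forall>a \<in> carrier_vec n.
          invariants_in (cmpoly.span (cpoly ` set gs)) a hs Fs =
          {(\<Sum>i<length gs. mpoly_scale (b $ i) (cpoly (gs ! i))) | b.
            b \<in> mat_kernel (map_mat (\<lambda>p. mpoly_eval (cpoly p) a) A)}))"
proof -
  obtain alg where alg: "\<And>n gs hs Fs y. certifies (n, gs, hs, Fs) y \<Longrightarrow> \<exists>N ys. certifies (n, gs, hs, Fs) (N, ys) \<and>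
     computes alg [list_encode [n, enc gs, enc hs, enc Fs]]
       (list_encode [length (input_rows (n, gs, hs, Fs) N), length gs, enc (input_rows (n, gs, hs, Fs) N)])"
    using algorithm_exists by blast
  show ?thesis
  proof (intro exI[of _ alg] allI impI, elim conjE)
    fix n c and gs hs :: "rat mpoly list" and Fs :: "rat mpoly list list"
    assume Fs: "\<forall>F \<in> set Fs. length F = n \<and> set F \<subseteq> mpolys n" and "input_code n gs hs Fs c"
    then obtain gts hts Fts where c: "c = list_encode [n, enc gts, enc hts, enc Fts]"
      and eqs: "gs = map sem gts" "hs = map sem hts" "Fs = map (map sem) Fts"
      and wf: "list_all (wf_terms n) gts" "list_all (wf_terms n) hts" "list_all (list_all (wf_terms n)) Fts"
      using input_code_decode by metis
    \<comment> \<open>The code yields well-formed terms; that each map has \<open>n\<close>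
      coordinates comes from the assumption on \<open>Fs\<close>.\<close>
    interpret loop_terms n gts hts Fts
      using wf Fs by unfold_locales (auto simp: eqs list_all_iff)
    obtain y where "certifies (n, gts, hts, Fts) y" using certificate_exists by blast
    from alg[OF this] obtain N ys where N: "certifies (n, gts, hts, Fts) (N, ys)"
      "computes alg [c] (list_encode [length (R N), length gts, enc (R N)])"
      unfolding R_def c by blast
    show "\<exists>(A :: rat mpoly mat) (d :: nat).
        computes alg [c] d \<and> matrix_code n A d \<and>
        elements_mat A \<subseteq> mpolys n \<and> dim_col A = length gs \<and>
        (\<forall>a \<in> carrier_vec n.
          invariants_in (cmpoly.span (cpoly ` set gs)) a hs Fs =
          {(\<Sum>i<length gs. mpoly_scale (b $ i) (cpoly (gs ! i))) | b.
            b \<in> mat_kernel (map_mat (\<lambda>p. mpoly_eval (cpoly p) a) A)})"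
    proof (intro exI conjI ballI)
      show "computes alg [c] (list_encode [length (R N), length gts, enc (R N)])" by fact
      show "matrix_code n (out_matrix N) (list_encode [length (R N), length gts, enc (R N)])"
        by (rule out_matrix_code)
      show "elements_mat (out_matrix N) \<subseteq> mpolys n" by (rule out_matrix_mpolys)
      show "dim_col (out_matrix N) = length gs" by (simp add: eqs)
      fix a :: "complex vec" assume "a \<in> carrier_vec n"
      then show "invariants_in (cmpoly.span (cpoly ` set gs)) a hs Fs =
          {(\<Sum>i<length gs. mpoly_scale (b $ i) (cpoly (gs ! i))) | b.
            b \<in> mat_kernel (map_mat (\<lambda>p. mpoly_eval (cpoly p) a) (out_matrix N))}"
        unfolding eqs by (rule invariants_eq_kernel[OF N(1)])
    qed
  qed
qed

end
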